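(* Let $A(x,v,1)=\sum_{n\ge2}\sum_{i=1}^n\sum_{j\ne i}a_n(i,j)v^ix^n$ and $U(x,v,1)=\sum_{n\ge2}\sum_{i=1}^n\sum_{j=1}^{n-1}u_n(i,j)v^ix^n$. Then $$A(x,v,1)+vx=U(x,v,1)+\frac{vx}{1-vqx}.$$
   Context: $a_n(i,j)=\sum q^{\mathrm{desc}(\pi)}$ over permutations $\pi$ of $[n]$ avoiding the patterns $1324$ and $1342$ with $\pi_1=i$, $\pi_2=j$, where $\mathrm{desc}$ counts descents. $\mathcal{U}_n$ is the set of sequences $e=e_1\cdots e_n$ of integers with $1\le e_i\le i$ such that there are no $i<j<k$ with $e_i\ge e_j$ and $e_i>e_k$; $\mathrm{dist}(e)$ is the number of distinct values of $e$, $\mathrm{last}(e)=e_n$, $\mathrm{hght}(e)=\max\{e_i:1\le i\le n-1,\ e_i\ge e_{i+1}\}$; $u_n(i,j)=\sum q^{\mathrm{dist}(e)-1}$ over $e\in\mathcal{U}_n$ with $\mathrm{last}(e)=i$ and $\mathrm{hght}(e)=j$. *)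

theory Defs
  imports
    "HOL-Library.Sublist"
    "HOL-Combinatorics.Multiset_Permutations"
    "HOL-Computational_Algebra.Computational_Algebra"
begin

text \<open>
  Permutations of \<open>{1..n}\<close> and the sequences below are lists (one-line notation). Lists are
  indexed from 0, so the entry written \<open>e\<^sub>k\<close> in 1-based notation is \<open>e ! (k - 1)\<close>.
\<close>

definition order_iso :: "nat list \<Rightarrow> nat list \<Rightarrow> bool" where
  "order_iso xs ys \<longleftrightarrow> length xs = length ys \<and>
     (\<forall>i<length xs. \<forall>j<length xs. xs ! i < xs ! j \<longleftrightarrow> ys ! i < ys ! j)"

definition avoids :: "nat list \<Rightarrow> nat list \<Rightarrow> bool" where
  "avoids w p \<longleftrightarrow> \<not> (\<exists>s. subseq s w \<and> order_iso s p)"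

definition desc :: "nat list \<Rightarrow> nat" where
  "desc w = card {k. Suc k < length w \<and> w ! k > w ! Suc k}"

definition avoiding_perms :: "nat \<Rightarrow> nat list set" where
  "avoiding_perms n =
     {w \<in> permutations_of_set {1..n}. avoids w [1,3,2,4] \<and> avoids w [1,3,4,2]}"

text \<open>
  Polynomials in \<open>q\<close> have type \<^typ>\<open>int poly\<close>, with \<open>q\<^sup>k\<close> being \<open>monom 1 k\<close>.
  The next definition is meant for \<open>n \<ge> 2\<close>.
\<close>

definition a_poly :: "nat \<Rightarrow> nat \<Rightarrow> nat \<Rightarrow> int poly" where
  "a_poly n i j = (\<Sum>w \<in> {w \<in> avoiding_perms n. w ! 0 = i \<and> w ! 1 = j}. monom 1 (desc w))"

definition U_seqs :: "nat \<Rightarrow> nat list set" where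
  "U_seqs n = {e. length e = n \<and> (\<forall>k<n. 1 \<le> e ! k \<and> e ! k \<le> Suc k) \<and>
     \<not> (\<exists>i j k. i < j \<and> j < k \<and> k < n \<and> e ! i \<ge> e ! j \<and> e ! i > e ! k)}"

definition num_distinct :: "nat list \<Rightarrow> nat" where
  "num_distinct e = card (set e)"

text \<open>
  A strictly increasing sequence has no weak descent; the value 0 assigned to it lies outside the
  range \<open>1 \<le> j \<le> n - 1\<close> of heights over which the generating function sums.
\<close>

definition hght :: "nat list \<Rightarrow> nat" where
  "hght e = (let H = {e ! k | k. Suc k < length e \<and> e ! k \<ge> e ! Suc k}
             in if H = {} then 0 else Max H)"

definition u_poly :: "nat \<Rightarrow> nat \<Rightarrow> nat \<Rightarrow> int poly" where
  "u_poly n i j = (\<Sum>e \<in> {e \<in> U_seqs n. last e = i \<and> hght e = j}. monom 1 (num_distinct e - 1))"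

lemma finite_avoiding_perms: "finite (avoiding_perms n)"
  by (simp add: avoiding_perms_def)

lemma finite_U_seqs: "finite (U_seqs n)"
proof (rule finite_subset)
  show "U_seqs n \<subseteq> {e. set e \<subseteq> {1..n} \<and> length e = n}"
    by (force simp: U_seqs_def in_set_conv_nth)
  show "finite {e. set e \<subseteq> {1..n} \<and> length e = n}"
    by (rule finite_lists_length_eq) simp
qed

text \<open>
  The generating functions are power series in \<open>x\<close> (\<^const>\<open>fps_X\<close>) with coefficients in the integer polynomials
  in \<open>v\<close> and \<open>q\<close> (\<^typ>\<open>int poly poly\<close>: outer variable \<open>v\<close>, inner variable \<open>q\<close>), embedded in
  their fraction field so that the library's division of power series is available.
\<close>

type_synonym coeff_field = "int poly poly fract"

definition var_v :: "coeff_field fps" where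
  "var_v = fps_const (to_fract (monom 1 1))"

definition var_q :: "coeff_field fps" where
  "var_q = fps_const (to_fract [:monom 1 1:])"

definition A_gf :: "coeff_field fps" where
  "A_gf = Abs_fps (\<lambda>n. if n \<ge> 2
     then to_fract (\<Sum>i\<in>{1..n}. \<Sum>j\<in>{1..n} - {i}. monom (a_poly n i j) i) else 0)"

definition U_gf :: "coeff_field fps" where
  "U_gf = Abs_fps (\<lambda>n. if n \<ge> 2
     then to_fract (\<Sum>i\<in>{1..n}. \<Sum>j\<in>{1..n-1}. monom (u_poly n i j) i) else 0)"

end

theory Submission
  imports Defs
begin

text \<open>
  For \<open>i \<le> n\<close> let \<open>x n i\<close> be the sum of \<open>q\<^bsup>desc\<^esup>\<close> over the avoiding permutations with first
  entry \<open>i\<close>, or the sum of \<open>q\<^bsup>dist - 1\<^esup>\<close> over the sequences with last entry \<open>i\<close>. Both arrays satisfy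
  \<open>x n i = (\<Sum>k=1..i. C k * x (n - k) (i + 1 - k))\<close> for \<open>i \<le> n - 2\<close> and \<open>x n (n - 1) = C (n - 1)\<close> for \<open>n \<ge> 3\<close>, where
  \<open>C\<close> is read off the earlier rows, together with \<open>x n n = q * (\<Sum>i<n. x (n - 1) i)\<close>; so they coincide.

  For permutations, insert entries in front: \<open>i\<close> may be prepended to \<open>w\<close> exactly if every entry of
  \<open>w\<close> that is at least \<open>i\<close> is extremal among the later such entries. This gives one-step recurrences for \<open>x\<close>
  that commute with the simultaneous shift of \<open>n\<close> and \<open>i\<close>, from which the convolution follows by
  induction. For sequences, cut at the last fixed point \<open>e\<^sub>k = k\<close>: everything after position
  \<open>k + 1\<close> is at least \<open>k\<close>, so what follows is a smaller sequence shifted by \<open>k - 1\<close>, and replacing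
  \<open>e\<^sub>k e\<^sub>k\<^sub>+\<^sub>1\<close> by \<open>e\<^sub>k\<^sub>+\<^sub>1\<close> in the initial part gives an arbitrary sequence of length \<open>k\<close>.
\<close>

section \<open>Subsequences\<close>

lemma subseq_Cons_Cons_iff:
  "subseq (a # ys) (x # xs) \<longleftrightarrow> a = x \<and> subseq ys xs \<or> subseq (a # ys) xs"
  by (auto dest: subseq_Cons')

lemma subseq_Cons_nth_iff:
  "subseq (a # ys) xs \<longleftrightarrow> (\<exists>i<length xs. xs ! i = a \<and> subseq ys (drop (Suc i) xs))"
proof (induction xs)
  case Nil
  then show ?case by simp
next
  case (Cons x xs)
  show ?case
    unfolding subseq_Cons_Cons_iff Cons.IH
    by (auto simp: less_Suc_eq_0_disj)
qed

lemma subseq_pair_cases: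
  assumes "y \<in> set xs" "z \<in> set xs" "y \<noteq> z"
  shows "subseq [y, z] xs \<or> subseq [z, y] xs"
  using assms by (induction xs) (auto simp: subseq_Cons_Cons_iff subseq_singleton_left)

lemma subseq_filter_iff:
  "subseq s (filter P xs) \<longleftrightarrow> subseq s xs \<and> (\<forall>y\<in>set s. P y)"
proof (induction xs arbitrary: s)
  case Nil
  then show ?case by (cases s) auto
next
  case (Cons x xs)
  show ?case
    by (cases s) (auto simp: Cons.IH subseq_Cons_Cons_iff)
qed

section \<open>The convolution recursion\<close>

text \<open>For \<open>k = 1\<close> the general formula would give \<open>x 1 1\<close>, which is 1
  in the arrays at hand. The additional \<open>q\<close> stems, for sequences, from a last fixed
  point at position \<open>n - 1\<close>: its contribution \<open>q * x (n - 1) i\<close> has the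
  shape of the summand \<open>k = 1\<close>.\<close>

definition conv_coeff :: "'a::comm_semiring_1 \<Rightarrow> (nat \<Rightarrow> nat \<Rightarrow> 'a) \<Rightarrow> nat \<Rightarrow> 'a" where
  "conv_coeff q x k = (if k = 1 then 1 + q else q * (\<Sum>i\<in>{1..<k}. x k i) + x k k)"

text \<open>
  In the recursion below \<open>x 2 1 = 1\<close> is an initial value of its own: it differs from \<open>conv_coeff q x 1 = 1 + q\<close>.
\<close>

definition conv_array :: "'a::comm_semiring_1 \<Rightarrow> (nat \<Rightarrow> nat \<Rightarrow> 'a) \<Rightarrow> bool" where
  "conv_array q x \<longleftrightarrow> x 1 1 = 1 \<and> x 2 1 = 1 \<and>
     (\<forall>n\<ge>1. x (Suc n) (Suc n) = q * (\<Sum>i\<in>{1..n}. x n i)) \<and>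
     (\<forall>n\<ge>2. x (Suc n) n = conv_coeff q x n) \<and>
     (\<forall>n i. 1 \<le> i \<and> i + 2 \<le> n \<longrightarrow> x n i = (\<Sum>k\<in>{1..i}. conv_coeff q x k * x (n - k) (i + 1 - k)))"

text \<open>Every right-hand side involves only rows before \<open>n\<close>, including the
  coefficients, as \<open>conv_coeff q x k\<close> depends at most on row \<open>k\<close>.\<close>

lemma conv_array_unique:
  assumes x: "conv_array q x" and y: "conv_array q y" and "1 \<le> i" "i \<le> n"
  shows "x n i = y n i"
  using assms(3,4)
proof (induction n arbitrary: i rule: less_induct)
  case (less n)
  have coeff: "conv_coeff q x k = conv_coeff q y k" if "1 \<le> k" "k < n" for k
    using less.IH[OF that(2)] that(1) by (auto simp: conv_coeff_def intro!: sum.cong)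
  consider "n = 1" | "n = 2" "i = 1" | "n \<ge> 2" "i = n" | "n \<ge> 3" "i = n - 1" | "i + 2 \<le> n"
    using less.prems by linarith
  then show ?case
  proof cases
    case 1
    then show ?thesis using x y less.prems by (auto simp: conv_array_def)
  next
    case 2
    then show ?thesis using x y by (auto simp: conv_array_def)
  next
    case 3
    then obtain m where m: "n = Suc m" "m \<ge> 1" by (cases n) auto
    have "(\<Sum>i\<in>{1..m}. x m i) = (\<Sum>i\<in>{1..m}. y m i)"
      using less.IH[of m] m by (intro sum.cong) auto
    then show ?thesis using x y m 3 by (simp add: conv_array_def)
  next
    case 4
    then obtain m where m: "n = Suc m" "m \<ge> 2" by (cases n) auto
    then show ?thesis using x y coeff[of m] 4 by (simp add: conv_array_def)
  next
    case 5
    have "(\<Sum>k\<in>{1..i}. conv_coeff q x k * x (n - k) (i + 1 - k)) =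
        (\<Sum>k\<in>{1..i}. conv_coeff q y k * y (n - k) (i + 1 - k))"
      using less.IH coeff 5 by (intro sum.cong refl arg_cong2[of _ _ _ _ "(*)"]) auto
    then show ?thesis using x y 5 less.prems by (simp add: conv_array_def)
  qed
qed

section \<open>Convolution from shift-invariant recurrences\<close>

lemma sum_shifted:
  "k \<ge> 1 \<Longrightarrow> (\<Sum>j\<in>{1..<i}. if k \<le> j then f (j + 1 - k) else 0) = (\<Sum>j\<in>{1..<i + 1 - k}. f j)"
  for f :: "nat \<Rightarrow> 'a::comm_monoid_add"
proof -
  assume k: "k \<ge> 1"
  have "(\<Sum>j\<in>{1..<i}. if k \<le> j then f (j + 1 - k) else 0) = (\<Sum>j\<in>{k..<i}. f (j + 1 - k))"
    using k by (intro sum.mono_neutral_cong_right) auto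
  also have "\<dots> = (\<Sum>j\<in>{1..<i + 1 - k}. f j)"
    using k by (intro sum.reindex_bij_witness[of _ "\<lambda>j. j + k - 1" "\<lambda>j. j + 1 - k"]) auto
  finally show ?thesis .
qed

text \<open>Both recurrences are linear and keep their form under
  \<open>(n, i) -> (n - k, i + 1 - k)\<close>, so a convolution for one row carries over to the next
  summand by summand. \<open>F\<close> and \<open>E\<close> are treated together because each
  recurrence uses the other array. The guard \<open>k \<le> i\<close> is there because truncated
  subtraction would otherwise reach the meaningless column 0.\<close>

lemma convolution_from_steps:
  fixes q :: "'a::comm_semiring_1" and F E :: "nat \<Rightarrow> nat \<Rightarrow> 'a" and C :: "nat \<Rightarrow> 'a"
  assumes F_Suc: "\<And>n i. n \<ge> 1 \<Longrightarrow> 1 \<le> i \<Longrightarrow> i \<le> Suc n \<Longrightarrow>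
      F (Suc (Suc n)) i = q * (\<Sum>j\<in>{1..<i}. F (Suc n) j) + F (Suc n) i + q * E n i"
    and E_Suc: "\<And>n i. n \<ge> 1 \<Longrightarrow> 1 \<le> i \<Longrightarrow>
      E (Suc n) i = (\<Sum>j\<in>{1..i}. F (Suc n) j) + q * E n i"
    and F_0: "\<And>n i. n \<le> i \<Longrightarrow> F n i = 0"
    and E_1: "\<And>i. 1 \<le> i \<Longrightarrow> E (Suc 0) i = 1"
    and F_2: "F 2 1 = 1"
    and C_1: "C 1 = 1 + q"
    and C: "\<And>n. n \<ge> 2 \<Longrightarrow> C n = F (Suc n) n"
    and m: "m \<ge> 1"
  shows "(\<forall>i\<ge>1. F (m + 2) i = (\<Sum>k\<in>{1..m}. C k * (if k \<le> i then F (m + 2 - k) (i + 1 - k) else 0)) +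
            (if i = m + 1 then C (m + 1) else 0)) \<and>
         (\<forall>i\<ge>1. E (m + 1) i = (\<Sum>k\<in>{1..m}. C k * (if k \<le> i then E (m + 1 - k) (i + 1 - k) else 0)))"
    (is "?PF m \<and> ?PE m")
  using m
proof (induction m rule: nat_induct_at_least)
  case base
  have "F 3 i = C 1 * F 2 i + (if i = 2 then C 2 else 0)" if i: "i \<ge> 1" for i
  proof -
    consider "i = 1" | "i = 2" | "i \<ge> 3" using i by linarith
    then show ?thesis
    proof cases
      case 1
      then show ?thesis using F_Suc[of 1 1] E_1[of 1] F_2 C_1 by (simp add: numeral_2_eq_2 numeral_3_eq_3)
    next
      case 2
      then show ?thesis using C[of 2] F_0[of 2 2] by simp
    next
      case 3
      then show ?thesis using F_0[of 2 i] F_0[of 3 i] by simp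
    qed
  qed
  then have "?PF 1" by (simp add: numeral_2_eq_2 numeral_3_eq_3)
  moreover have "?PE 1"
  proof (intro allI impI)
    fix i :: nat assume i: "i \<ge> 1"
    have "(\<Sum>j\<in>{1..i}. F 2 j) = (\<Sum>j\<in>{1}. F 2 j)"
      using i F_0[of 2] by (intro sum.mono_neutral_right) auto
    then show "E (1 + 1) i = (\<Sum>k\<in>{1..1}. C k * (if k \<le> i then E (1 + 1 - k) (i + 1 - k) else 0))"
      using E_Suc[of 1 i] E_1[of i] i F_2 C_1 by (simp add: numeral_2_eq_2)
  qed
  ultimately show ?case by (simp del: One_nat_def)
next
  case (Suc m)
  \<comment> \<open>\<open>S\<close> is the convolution over the old range of \<open>k\<close>; its
    linearity turns a recurrence for rows into one for the summands.\<close>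
  define S where "S = (\<lambda>g. \<Sum>k\<in>{1..m}. C k * g k)"
  have S_cong: "S g = S h" if "\<And>k. 1 \<le> k \<Longrightarrow> k \<le> m \<Longrightarrow> g k = h k" for g h
    unfolding S_def using that by (intro sum.cong) auto
  have S_add: "S g + S h = S (\<lambda>k. g k + h k)" for g h
    unfolding S_def by (simp add: sum.distrib algebra_simps)
  have S_mult: "q * S g = S (\<lambda>k. q * g k)" for g
    unfolding S_def by (simp add: sum_distrib_left algebra_simps)
  have F: "F (m + 2) i = S (\<lambda>k. if k \<le> i then F (m + 2 - k) (i + 1 - k) else 0) +
      (if i = m + 1 then C (m + 1) else 0)" if "i \<ge> 1" for i
    using Suc.IH that by (simp add: S_def)
  have E: "E (m + 1) i = S (\<lambda>k. if k \<le> i then E (m + 1 - k) (i + 1 - k) else 0)" if "i \<ge> 1" for i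
    using Suc.IH that by (simp add: S_def)
  have sum_F: "(\<Sum>j\<in>{1..<i}. F (m + 2) j) =
      S (\<lambda>k. \<Sum>j\<in>{1..<i + 1 - k}. F (m + 2 - k) j) + (if m + 1 < i then C (m + 1) else 0)" for i
  proof -
    have "(\<Sum>j\<in>{1..<i}. F (m + 2) j) =
        (\<Sum>j\<in>{1..<i}. S (\<lambda>k. if k \<le> j then F (m + 2 - k) (j + 1 - k) else 0)) +
        (\<Sum>j\<in>{1..<i}. if j = m + 1 then C (m + 1) else 0)"
      unfolding sum.distrib[symmetric] by (intro sum.cong refl F) auto
    also have "(\<Sum>j\<in>{1..<i}. S (\<lambda>k. if k \<le> j then F (m + 2 - k) (j + 1 - k) else 0)) =
        S (\<lambda>k. \<Sum>j\<in>{1..<i}. if k \<le> j then F (m + 2 - k) (j + 1 - k) else 0)"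
      unfolding S_def by (subst sum.swap) (simp add: sum_distrib_left)
    also have "\<dots> = S (\<lambda>k. \<Sum>j\<in>{1..<i + 1 - k}. F (m + 2 - k) j)"
      by (intro S_cong sum_shifted)
    also have "(\<Sum>j\<in>{1..<i}. if j = m + 1 then C (m + 1) else 0) = (if m + 1 < i then C (m + 1) else 0)"
      by simp
    finally show ?thesis .
  qed
  have "?PF (Suc m)"
  proof (intro allI impI)
    fix i :: nat assume i: "i \<ge> 1"
    have split: "(\<Sum>k\<in>{1..Suc m}. C k * (if k \<le> i then F (Suc m + 2 - k) (i + 1 - k) else 0)) =
        S (\<lambda>k. if k \<le> i then F (m + 3 - k) (i + 1 - k) else 0) +
        C (m + 1) * (if m + 1 \<le> i then F 2 (i - m) else 0)"
    proof -
      have "Suc m + 2 = m + 3" by simp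
      then show ?thesis by (simp only: S_def) simp
    qed
    \<comment> \<open>For \<open>i \<le> m + 1\<close> the recurrence applies to each summand. From
      \<open>i = m + 2\<close> on all shifted entries vanish by \<open>F_0\<close>, and only the
      boundary value \<open>C (m + 2)\<close> at \<open>i = m + 2\<close> remains.\<close>
    consider "i \<le> m + 1" | "i = m + 2" | "i > m + 2" by linarith
    then show "F (Suc m + 2) i =
      (\<Sum>k\<in>{1..Suc m}. C k * (if k \<le> i then F (Suc m + 2 - k) (i + 1 - k) else 0)) +
      (if i = Suc m + 1 then C (Suc m + 1) else 0)"
    proof cases
      case 1
      have "F (m + 3) i = q * (\<Sum>j\<in>{1..<i}. F (m + 2) j) + F (m + 2) i + q * E (m + 1) i"
        using F_Suc[of "m + 1" i] i 1 by (simp add: numeral_2_eq_2 numeral_3_eq_3)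
      also have "\<dots> = S (\<lambda>k. q * (\<Sum>j\<in>{1..<i + 1 - k}. F (m + 2 - k) j) +
          (if k \<le> i then F (m + 2 - k) (i + 1 - k) else 0) +
          q * (if k \<le> i then E (m + 1 - k) (i + 1 - k) else 0)) + (if i = m + 1 then C (m + 1) else 0)"
        using 1 unfolding sum_F F[OF i] E[OF i] S_add[symmetric] S_mult[symmetric] by (simp add: add_ac)
      also have "S (\<lambda>k. q * (\<Sum>j\<in>{1..<i + 1 - k}. F (m + 2 - k) j) +
          (if k \<le> i then F (m + 2 - k) (i + 1 - k) else 0) +
          q * (if k \<le> i then E (m + 1 - k) (i + 1 - k) else 0)) =
          S (\<lambda>k. if k \<le> i then F (m + 3 - k) (i + 1 - k) else 0)"
      proof (rule S_cong)
        fix k assume k: "1 \<le> k" "k \<le> m"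
        have "F (m + 3 - k) (i + 1 - k) = q * (\<Sum>j\<in>{1..<i + 1 - k}. F (m + 2 - k) j) +
          F (m + 2 - k) (i + 1 - k) + q * E (m + 1 - k) (i + 1 - k)" if "k \<le> i"
          using F_Suc[of "m + 1 - k" "i + 1 - k"] k 1 that
          by (simp add: Suc_diff_le numeral_2_eq_2 numeral_3_eq_3)
        then show "q * (\<Sum>j\<in>{1..<i + 1 - k}. F (m + 2 - k) j) +
          (if k \<le> i then F (m + 2 - k) (i + 1 - k) else 0) +
          q * (if k \<le> i then E (m + 1 - k) (i + 1 - k) else 0) =
          (if k \<le> i then F (m + 3 - k) (i + 1 - k) else 0)"
          by simp
      qed
      \<comment> \<open>The former boundary term at \<open>i = m + 1\<close> is the new summand
        \<open>k = m + 1\<close>, because \<open>F 2 1 = 1\<close>.\<close>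
      finally show ?thesis
        unfolding split using 1 F_2 by (simp add: numeral_2_eq_2 numeral_3_eq_3)
    next
      case 2
      have "S (\<lambda>k. if k \<le> i then F (m + 3 - k) (i + 1 - k) else 0) = S (\<lambda>k. 0)"
        using 2 by (intro S_cong) (auto intro!: F_0)
      then have "S (\<lambda>k. if k \<le> i then F (m + 3 - k) (i + 1 - k) else 0) = 0"
        by (simp add: S_def)
      then show ?thesis
        unfolding split using 2 F_0[of 2 2] C[of "m + 2"] by (simp add: numeral_2_eq_2 numeral_3_eq_3)
    next
      case 3
      have "S (\<lambda>k. if k \<le> i then F (m + 3 - k) (i + 1 - k) else 0) = S (\<lambda>k. 0)"
        using 3 by (intro S_cong) (auto intro!: F_0)
      then have "S (\<lambda>k. if k \<le> i then F (m + 3 - k) (i + 1 - k) else 0) = 0"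
        by (simp add: S_def)
      then show ?thesis
        unfolding split using 3 F_0[of 2 "i - m"] F_0[of "m + 3" i]
        by (simp add: numeral_2_eq_2 numeral_3_eq_3)
    qed
  qed
  moreover have "?PE (Suc m)"
  proof (intro allI impI)
    fix i :: nat assume i: "i \<ge> 1"
    have "E (m + 2) i = (\<Sum>j\<in>{1..<i + 1}. F (m + 2) j) + q * E (m + 1) i"
      using E_Suc[of "m + 1" i] i by (simp add: atLeastLessThanSuc_atLeastAtMost)
    also have "\<dots> = S (\<lambda>k. (\<Sum>j\<in>{1..<i + 1 + 1 - k}. F (m + 2 - k) j) +
          q * (if k \<le> i then E (m + 1 - k) (i + 1 - k) else 0)) + (if m + 1 \<le> i then C (m + 1) else 0)"
      unfolding sum_F E[OF i] S_add[symmetric] S_mult[symmetric] by (simp add: add_ac less_Suc_eq_le)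
    also have "S (\<lambda>k. (\<Sum>j\<in>{1..<i + 1 + 1 - k}. F (m + 2 - k) j) +
          q * (if k \<le> i then E (m + 1 - k) (i + 1 - k) else 0)) =
        S (\<lambda>k. if k \<le> i then E (m + 2 - k) (i + 1 - k) else 0)"
    proof (rule S_cong)
      fix k assume k: "1 \<le> k" "k \<le> m"
      have "E (m + 2 - k) (i + 1 - k) = (\<Sum>j\<in>{1..<i + 1 + 1 - k}. F (m + 2 - k) j) +
          q * E (m + 1 - k) (i + 1 - k)" if "k \<le> i"
        using E_Suc[of "m + 1 - k" "i + 1 - k"] k that
        by (simp add: Suc_diff_le atLeastLessThanSuc_atLeastAtMost)
      moreover have "{1..<i + 1 + 1 - k} = {}" if "\<not> k \<le> i"
        using that by auto
      ultimately show "(\<Sum>j\<in>{1..<i + 1 + 1 - k}. F (m + 2 - k) j) +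
          q * (if k \<le> i then E (m + 1 - k) (i + 1 - k) else 0) =
          (if k \<le> i then E (m + 2 - k) (i + 1 - k) else 0)"
        by simp
    qed
    \<comment> \<open>The leftover \<open>C (m + 1)\<close> for \<open>i \<ge> m + 1\<close> is the
      summand \<open>k = m + 1\<close>, because \<open>E (Suc 0)\<close> is 1 in all columns from 1
      on.\<close>
    finally show "E (Suc m + 1) i =
        (\<Sum>k\<in>{1..Suc m}. C k * (if k \<le> i then E (Suc m + 1 - k) (i + 1 - k) else 0))"
      using E_1[of "i - m"] by (auto simp: S_def intro!: sum.cong)
  qed
  ultimately show ?case ..
qed

section \<open>Avoiding permutations\<close>

text \<open>On lists of distinct numbers, each entry is the minimum or the maximum of the suffix
  that it starts; this is avoidance of 213 and 231.\<close>

fun extremal :: "nat list \<Rightarrow> bool" where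
  "extremal [] \<longleftrightarrow> True"
| "extremal (x # xs) \<longleftrightarrow> \<not> (\<exists>y\<in>set xs. \<exists>z\<in>set xs. y < x \<and> x < z) \<and> extremal xs"

text \<open>Deleting the leading 1 of 1324 and 1342 leaves 213 and 231, so it is enough to forbid
  those two among the larger entries to the right of each entry.\<close>

fun tails_extremal :: "nat list \<Rightarrow> bool" where
  "tails_extremal [] \<longleftrightarrow> True"
| "tails_extremal (x # xs) \<longleftrightarrow> extremal (filter (\<lambda>y. x < y) xs) \<and> tails_extremal xs"

text \<open>A later smaller and a later larger entry occur in one order or the other; the two orders
  are the patterns 213 and 231.\<close>

lemma extremal_iff:
  "extremal xs \<longleftrightarrow> \<not> (\<exists>b c d. subseq [b, c, d] xs \<and> (c < b \<and> b < d \<or> d < b \<and> b < c))"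
proof (induction xs)
  case Nil
  then show ?case by simp
next
  case (Cons x xs)
  have "(\<exists>y\<in>set xs. \<exists>z\<in>set xs. y < x \<and> x < z) \<longleftrightarrow>
      (\<exists>c d. subseq [c, d] xs \<and> (c < x \<and> x < d \<or> d < x \<and> x < c))"
  proof
    assume "\<exists>y\<in>set xs. \<exists>z\<in>set xs. y < x \<and> x < z"
    then show "\<exists>c d. subseq [c, d] xs \<and> (c < x \<and> x < d \<or> d < x \<and> x < c)"
      using subseq_pair_cases by (metis less_irrefl order.strict_trans)
  next
    assume "\<exists>c d. subseq [c, d] xs \<and> (c < x \<and> x < d \<or> d < x \<and> x < c)"
    moreover have "c \<in> set xs \<and> d \<in> set xs" if "subseq [c, d] xs" for c d
      using that by (metis subseq_Cons' subseq_singleton_left subseq_order.order_trans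
          list_emb_Nil subseq_Cons2)
    ultimately show "\<exists>y\<in>set xs. \<exists>z\<in>set xs. y < x \<and> x < z" by metis
  qed
  then show ?case
    by (simp only: extremal.simps Cons.IH subseq_Cons_Cons_iff) blast
qed

lemma tails_extremal_iff:
  "tails_extremal xs \<longleftrightarrow> \<not> (\<exists>a b c d. subseq [a, b, c, d] xs \<and> a < b \<and> a < c \<and> a < d \<and>
     (c < b \<and> b < d \<or> d < b \<and> b < c))"
proof (induction xs)
  case Nil
  then show ?case by simp
next
  case (Cons x xs)
  show ?case
    by (simp only: tails_extremal.simps Cons.IH subseq_Cons_Cons_iff extremal_iff subseq_filter_iff)
      (simp, blast)
qed

lemma order_iso_length_4_iff:
  "order_iso s [x, y, z, t] \<longleftrightarrow> (\<exists>a b c d. s = [a, b, c, d] \<and> order_iso [a, b, c, d] [x, y, z, t])"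
proof
  assume s: "order_iso s [x, y, z, t]"
  then have "length s = Suc (Suc (Suc (Suc 0)))"
    by (simp add: order_iso_def)
  then obtain a b c d where "s = [a, b, c, d]"
    by (auto simp: length_Suc_conv)
  with s show "\<exists>a b c d. s = [a, b, c, d] \<and> order_iso [a, b, c, d] [x, y, z, t]"
    by blast
qed auto

lemma order_iso_1324:
  "order_iso s [1, 3, 2, 4] \<longleftrightarrow> (\<exists>a b c d. s = [a, b, c, d] \<and> a < c \<and> c < b \<and> b < d)"
proof -
  have "order_iso [a, b, c, d] [1, 3, 2, 4] \<longleftrightarrow> a < c \<and> c < b \<and> b < d" for a b c d
    by (simp add: order_iso_def All_less_Suc numeral_eq_Suc) linarith
  then show ?thesis
    by (subst order_iso_length_4_iff) simp
qed

lemma order_iso_1342: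
  "order_iso s [1, 3, 4, 2] \<longleftrightarrow> (\<exists>a b c d. s = [a, b, c, d] \<and> a < d \<and> d < b \<and> b < c)"
proof -
  have "order_iso [a, b, c, d] [1, 3, 4, 2] \<longleftrightarrow> a < d \<and> d < b \<and> b < c" for a b c d
    by (simp add: order_iso_def All_less_Suc numeral_eq_Suc) linarith
  then show ?thesis
    by (subst order_iso_length_4_iff) simp
qed

lemma avoiding_perms_altdef:
  "avoiding_perms n = {w \<in> permutations_of_set {1..n}. tails_extremal w}"
proof -
  have "avoids w [1,3,2,4] \<and> avoids w [1,3,4,2] \<longleftrightarrow> tails_extremal w" for w
  proof
    assume w: "avoids w [1,3,2,4] \<and> avoids w [1,3,4,2]"
    have False if "subseq [a, b, c, d] w" "a < b" "a < c" "a < d"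
      "c < b \<and> b < d \<or> d < b \<and> b < c" for a b c d
      using that(5)
    proof
      assume "c < b \<and> b < d"
      then have "order_iso [a, b, c, d] [1,3,2,4]" using that(3) unfolding order_iso_1324 by simp
      then show False using w that(1) unfolding avoids_def by blast
    next
      assume "d < b \<and> b < c"
      then have "order_iso [a, b, c, d] [1,3,4,2]" using that(4) unfolding order_iso_1342 by simp
      then show False using w that(1) unfolding avoids_def by blast
    qed
    then show "tails_extremal w" unfolding tails_extremal_iff by blast
  next
    assume w: "tails_extremal w"
    have False if s: "subseq s w" "order_iso s [1,3,2,4] \<or> order_iso s [1,3,4,2]" for s
    proof -
      from s(2) obtain a b c d where "s = [a, b, c, d]" "a < b" "a < c" "a < d"
        "c < b \<and> b < d \<or> d < b \<and> b < c"
        unfolding order_iso_1324 order_iso_1342 by (elim disjE exE conjE) auto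
      then show False using w s(1) unfolding tails_extremal_iff by blast
    qed
    then show "avoids w [1,3,2,4] \<and> avoids w [1,3,4,2]" unfolding avoids_def by blast
  qed
  then show ?thesis by (simp only: avoiding_perms_def)
qed

lemma extremal_map_strict_mono: "strict_mono f \<Longrightarrow> extremal (map f xs) \<longleftrightarrow> extremal xs"
  by (induction xs) (auto simp: strict_mono_less)

lemma tails_extremal_map_strict_mono:
  "strict_mono f \<Longrightarrow> tails_extremal (map f xs) \<longleftrightarrow> tails_extremal xs"
  by (induction xs)
    (auto simp: strict_mono_less filter_map comp_def extremal_map_strict_mono)

lemma extremal_filter: "extremal xs \<Longrightarrow> extremal (filter P xs)"
  by (induction xs) auto

lemma extremal_filter_mono:
  assumes "extremal (filter P xs)" "\<And>x. x \<in> set xs \<Longrightarrow> Q x \<Longrightarrow> P x"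
  shows "extremal (filter Q xs)"
proof -
  have "filter Q xs = filter Q (filter P xs)"
    using assms(2) by (auto intro!: filter_cong)
  then show ?thesis using extremal_filter[OF assms(1)] by metis
qed

section \<open>Descents and prepending an entry\<close>

lemma desc_simps [simp]:
  "desc [] = 0" "desc [x] = 0"
  "desc (x # y # w) = (if x > y then 1 else 0) + desc (y # w)"
proof -
  let ?D = "\<lambda>w :: nat list. {k. Suc k < length w \<and> w ! k > w ! Suc k}"
  have "?D (x # y # w) = (if x > y then {0} else {}) \<union> Suc ` ?D (y # w)"
  proof (intro set_eqI)
    fix k
    show "k \<in> ?D (x # y # w) \<longleftrightarrow> k \<in> (if x > y then {0} else {}) \<union> Suc ` ?D (y # w)"
      by (cases k) (auto simp: image_iff)
  qed
  moreover have "finite (?D (y # w))"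
    by (rule finite_subset[of _ "{..<length (y # w)}"]) auto
  ultimately show "desc (x # y # w) = (if x > y then 1 else 0) + desc (y # w)"
    unfolding desc_def by (subst card_Un_disjoint[symmetric] | auto simp: card_image)+
qed (simp_all add: desc_def)

lemma desc_Cons: "w \<noteq> [] \<Longrightarrow> desc (x # w) = (if x > hd w then 1 else 0) + desc w"
  by (cases w) auto

lemma desc_map_strict_mono: "strict_mono f \<Longrightarrow> desc (map f w) = desc w"
  by (simp add: desc_def strict_mono_less cong: conj_cong)

text \<open>The increasing relabelling that frees the value \<open>i\<close>: for a permutation
  \<open>w\<close>, \<open>i # map (shift i) w\<close> is the permutation starting with
  \<open>i\<close> whose tail standardizes to \<open>w\<close>.\<close>

definition shift :: "nat \<Rightarrow> nat \<Rightarrow> nat" where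
  "shift i x = (if x < i then x else Suc x)"

lemma strict_mono_shift: "strict_mono (shift i)"
  by (auto simp: strict_mono_def shift_def)

lemma shift_image: "1 \<le> i \<Longrightarrow> i \<le> Suc n \<Longrightarrow> shift i ` {1..n} = {1..Suc n} - {i}"
proof (intro equalityI subsetI)
  fix x assume "1 \<le> i" "i \<le> Suc n" "x \<in> {1..Suc n} - {i}"
  then show "x \<in> shift i ` {1..n}"
    by (intro image_eqI[of _ _ "if x < i then x else x - 1"]) (auto simp: shift_def)
qed (auto simp: shift_def)

text \<open>The condition under which prepending \<open>i\<close> to \<open>w\<close> (after standardization) creates no forbidden pattern.\<close>

definition compatible :: "nat \<Rightarrow> nat list \<Rightarrow> bool" where
  "compatible i w \<longleftrightarrow> extremal (filter (\<lambda>y. i \<le> y) w)"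

text \<open>The entries above \<open>i\<close> after relabelling come exactly from the entries of
  \<open>w\<close> that are at least \<open>i\<close>, and an increasing relabelling preserves both
  conditions.\<close>

lemma tails_extremal_insert:
  "tails_extremal (i # map (shift i) w) \<longleftrightarrow> compatible i w \<and> tails_extremal w"
proof -
  have "filter (\<lambda>y. i < y) (map (shift i) w) = map (shift i) (filter (\<lambda>y. i \<le> y) w)"
    by (auto simp: filter_map comp_def shift_def not_less intro!: filter_cong)
  then show ?thesis
    by (simp add: compatible_def extremal_map_strict_mono tails_extremal_map_strict_mono
        strict_mono_shift)
qed

text \<open>\<open>shift i\<close> maps \<open>{1..n}\<close> bijectively onto the values other than
  \<open>i\<close>, so all permutations starting with \<open>i\<close> arise this way;
  \<open>tails_extremal_insert\<close> selects the avoiding ones.\<close>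

lemma avoiding_perms_with_head:
  assumes "1 \<le> i" "i \<le> Suc n"
  shows "{w \<in> avoiding_perms (Suc n). w ! 0 = i} =
    (\<lambda>w. i # map (shift i) w) ` {w \<in> avoiding_perms n. compatible i w}"
proof -
  have inj: "inj_on (shift i) {1..n}"
    by (auto simp: inj_on_def shift_def split: if_splits)
  have "{w \<in> permutations_of_set {1..Suc n}. w ! 0 = i} =
      (#) i ` permutations_of_set ({1..Suc n} - {i})"
    using assms by (subst permutations_of_set_nonempty) auto
  also have "\<dots> = (\<lambda>w. i # map (shift i) w) ` permutations_of_set {1..n}"
    unfolding shift_image[OF assms, symmetric] permutations_of_set_image_inj[OF inj] image_image ..
  finally have heads: "{w \<in> permutations_of_set {1..Suc n}. w ! 0 = i} =
      (\<lambda>w. i # map (shift i) w) ` permutations_of_set {1..n}" .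
  have "{w \<in> avoiding_perms (Suc n). w ! 0 = i} =
      {w \<in> {w \<in> permutations_of_set {1..Suc n}. w ! 0 = i}. tails_extremal w}"
    unfolding avoiding_perms_altdef by (simp only: mem_Collect_eq conj_ac)
  also have "\<dots> = (\<lambda>w. i # map (shift i) w) `
      {w \<in> permutations_of_set {1..n}. tails_extremal (i # map (shift i) w)}"
    unfolding heads by (simp only: Collect_conj_eq) fast
  also have "{w \<in> permutations_of_set {1..n}. tails_extremal (i # map (shift i) w)} =
      {w \<in> avoiding_perms n. compatible i w}"
    unfolding avoiding_perms_altdef tails_extremal_insert by (simp only: mem_Collect_eq conj_ac)
  finally show ?thesis .
qed

section \<open>Weighted sums by first entry\<close>

definition perm_sum :: "'a::comm_semiring_1 \<Rightarrow> nat \<Rightarrow> nat \<Rightarrow> 'a" where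
  "perm_sum q n i = (\<Sum>w \<in> {w \<in> avoiding_perms n. w ! 0 = i}. q ^ desc w)"

text \<open>Takes the place of \<open>E\<close> in \<open>convolution_from_steps\<close>. Here
  \<open>i\<close> may exceed \<open>n\<close>; from \<open>i = n\<close> on the condition on
  \<open>w\<close> always holds.\<close>

definition compatible_sum :: "'a::comm_semiring_1 \<Rightarrow> nat \<Rightarrow> nat \<Rightarrow> 'a" where
  "compatible_sum q n i = (\<Sum>w \<in> {w \<in> avoiding_perms n. compatible i w}. q ^ desc w)"

lemma avoiding_permsD:
  assumes "w \<in> avoiding_perms n"
  shows "set w = {1..n}" "length w = n"
  using assms length_finite_permutations_of_set[of w "{1..n}"]
  by (auto simp: avoiding_perms_altdef permutations_of_set_def)

lemma desc_insert:
  "w \<noteq> [] \<Longrightarrow> desc (i # map (shift i) w) = (if w ! 0 < i then 1 else 0) + desc w"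
  by (subst desc_Cons) (auto simp: desc_map_strict_mono strict_mono_shift hd_conv_nth shift_def)

text \<open>A descent is created at the front exactly if \<open>w ! 0 < i\<close>, because
  \<open>shift i\<close> fixes the entries below \<open>i\<close> and moves the others above
  it.\<close>

lemma perm_sum_Suc:
  assumes "n \<ge> 1" "1 \<le> i" "i \<le> Suc n"
  shows "perm_sum q (Suc n) i =
    (\<Sum>w \<in> {w \<in> avoiding_perms n. compatible i w}. q ^ desc w * (if w ! 0 < i then q else 1))"
proof -
  have "inj (\<lambda>w. i # map (shift i) w)"
    by (rule injI) (simp add: inj_map_eq_map strict_mono_imp_inj_on[OF strict_mono_shift])
  moreover have "w \<noteq> []" if "w \<in> avoiding_perms n" for w
    using avoiding_permsD(2)[OF that] assms(1) by auto
  ultimately show ?thesis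
    unfolding perm_sum_def avoiding_perms_with_head[OF assms(2,3)]
    by (subst sum.reindex) (auto simp: desc_insert mult.commute intro: inj_on_subset intro!: sum.cong)
qed

lemma compatible_mono: "compatible i w \<Longrightarrow> i \<le> j \<Longrightarrow> compatible j w"
  unfolding compatible_def by (erule extremal_filter_mono) auto

text \<open>If \<open>i < j\<close>, then \<open>i\<close> and \<open>Suc n\<close> both follow the
  head and enclose \<open>j\<close>, violating extremality. If \<open>j \<le> i\<close>, the tail is
  extremal from \<open>j\<close> upwards since \<open>w\<close> itself avoids the patterns, and
  \<open>j\<close> in front is minimal there.\<close>

lemma compatible_head:
  assumes w: "w \<in> avoiding_perms (Suc n)" "w ! 0 = j" and j: "1 \<le> j" "j \<le> n" and i: "1 \<le> i"
  shows "compatible i w \<longleftrightarrow> j \<le> i"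
proof -
  from w j obtain u where u: "w = j # map (shift j) u" "compatible j u"
    using avoiding_perms_with_head[of j n] by (auto simp: set_eq_iff)
  have "set w = {1..Suc n}" using avoiding_permsD(1) w(1) .
  show ?thesis
  proof
    assume c: "compatible i w"
    show "j \<le> i"
    proof (rule ccontr)
      assume "\<not> j \<le> i"
      moreover have "i \<in> set w" "Suc n \<in> set w"
        using \<open>\<not> j \<le> i\<close> i j \<open>set w = {1..Suc n}\<close> by auto
      ultimately have "i \<in> set (map (shift j) u)" "Suc n \<in> set (map (shift j) u)"
        unfolding u(1) using j by auto
      then have "i \<in> set (filter (\<lambda>y. i \<le> y) (map (shift j) u))"
        "Suc n \<in> set (filter (\<lambda>y. i \<le> y) (map (shift j) u))"
        using \<open>\<not> j \<le> i\<close> j by auto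
      moreover have "extremal (j # filter (\<lambda>y. i \<le> y) (map (shift j) u))"
        using c \<open>\<not> j \<le> i\<close> unfolding u(1) compatible_def by simp
      moreover have "i < j" "j < Suc n" using \<open>\<not> j \<le> i\<close> j by auto
      ultimately show False unfolding extremal.simps by blast
    qed
  next
    assume "j \<le> i"
    have "compatible j (map (shift j) u)"
    proof -
      have "filter (\<lambda>y. j \<le> y) (map (shift j) u) = map (shift j) (filter (\<lambda>y. j \<le> y) u)"
        by (auto simp: filter_map comp_def shift_def not_less intro!: filter_cong)
      then show ?thesis
        using u(2) by (simp add: compatible_def extremal_map_strict_mono strict_mono_shift)
    qed
    then have "compatible j w"
      unfolding u(1) compatible_def by auto
    then show "compatible i w" using \<open>j \<le> i\<close> by (rule compatible_mono)
  qed
qed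

text \<open>A leading maximum never lies strictly between two later entries.\<close>

lemma compatible_insert_max:
  assumes "w \<in> avoiding_perms n"
  shows "compatible i (Suc n # map (shift (Suc n)) w) \<longleftrightarrow> compatible i w"
proof -
  have "map (shift (Suc n)) w = w"
    using avoiding_permsD(1)[OF assms] by (intro map_idI) (auto simp: shift_def)
  moreover have "\<forall>x\<in>set w. x < Suc n"
    using avoiding_permsD(1)[OF assms] by auto
  ultimately show ?thesis
    by (auto simp: compatible_def)
qed

lemma compatible_trivial: "w \<in> avoiding_perms n \<Longrightarrow> n \<le> i \<Longrightarrow> compatible i w"
proof -
  assume w: "w \<in> avoiding_perms n" "n \<le> i"
  then have "\<forall>y\<in>set (filter (\<lambda>y. i \<le> y) w). y = i"
    using avoiding_permsD(1) by fastforce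
  moreover have "extremal xs" if "\<forall>y\<in>set xs. y = i" for xs
    using that by (induction xs) auto
  ultimately have "extremal (filter (\<lambda>y. i \<le> y) w)"
    by blast
  then show ?thesis by (simp add: compatible_def)
qed

lemma sum_compatible_by_head:
  assumes "n \<ge> 1" "1 \<le> i"
  shows "(\<Sum>w \<in> {w \<in> avoiding_perms (Suc n). compatible i w}. q ^ desc w * g (w ! 0)) =
    (\<Sum>j \<in> {1..min i n}. perm_sum q (Suc n) j * g j) + q * compatible_sum q n i * g (Suc n)"
    (is "(\<Sum>w\<in>?S. ?h w) = _")
proof -
  have fin: "finite ?S" by (simp add: finite_avoiding_perms)
  have heads: "(\<lambda>w. w ! 0) ` ?S \<subseteq> {1..Suc n}"
  proof -
    have "w ! 0 \<in> {1..Suc n}" if "w \<in> avoiding_perms (Suc n)" for w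
      using avoiding_permsD[OF that] by (metis nth_mem zero_less_Suc)
    then show ?thesis by auto
  qed
  have "(\<Sum>w\<in>?S. ?h w) = (\<Sum>j\<in>{1..Suc n}. \<Sum>w\<in>{w\<in>?S. w ! 0 = j}. ?h w)"
    by (rule sum.group[symmetric, OF fin _ heads]) simp
  also have "\<dots> = (\<Sum>j\<in>{1..n}. \<Sum>w\<in>{w\<in>?S. w ! 0 = j}. ?h w) + (\<Sum>w\<in>{w\<in>?S. w ! 0 = Suc n}. ?h w)"
    by simp
  also have "(\<Sum>j\<in>{1..n}. \<Sum>w\<in>{w\<in>?S. w ! 0 = j}. ?h w) =
      (\<Sum>j\<in>{1..n}. if j \<le> i then perm_sum q (Suc n) j * g j else 0)"
  proof (rule sum.cong[OF refl])
    fix j assume j: "j \<in> {1..n}"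
    have "{w\<in>?S. w ! 0 = j} = (if j \<le> i then {w \<in> avoiding_perms (Suc n). w ! 0 = j} else {})"
      using compatible_head[of _ n j i] j assms by auto
    then show "(\<Sum>w\<in>{w\<in>?S. w ! 0 = j}. ?h w) = (if j \<le> i then perm_sum q (Suc n) j * g j else 0)"
      by (auto simp: perm_sum_def sum_distrib_right)
  qed
  also have "\<dots> = (\<Sum>j \<in> {1..min i n}. perm_sum q (Suc n) j * g j)"
    by (rule sum.mono_neutral_cong_right) auto
  also have "(\<Sum>w\<in>{w\<in>?S. w ! 0 = Suc n}. ?h w) = q * compatible_sum q n i * g (Suc n)"
  proof -
    let ?f = "\<lambda>w. Suc n # map (shift (Suc n)) w"
    have "{w\<in>?S. w ! 0 = Suc n} = {w \<in> {w \<in> avoiding_perms (Suc n). w ! 0 = Suc n}. compatible i w}"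
      by auto
    also have "\<dots> = {w \<in> ?f ` {w \<in> avoiding_perms n. compatible (Suc n) w}. compatible i w}"
      by (subst avoiding_perms_with_head) auto
    also have "\<dots> = ?f ` {w \<in> avoiding_perms n. compatible i w}"
      using compatible_insert_max[of _ n i] compatible_trivial[of _ n "Suc n"] by auto
    finally have eq: "{w\<in>?S. w ! 0 = Suc n} = ?f ` {w \<in> avoiding_perms n. compatible i w}" .
    have inj: "inj ?f"
      by (rule injI) (simp add: inj_map_eq_map strict_mono_imp_inj_on[OF strict_mono_shift])
    have "desc (?f w) = Suc (desc w)" if "w \<in> avoiding_perms n" for w
    proof -
      have "w \<noteq> []" "w ! 0 < Suc n"
        using avoiding_permsD[OF that] assms(1) nth_mem[of 0 w] by auto
      then show ?thesis by (simp add: desc_insert)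
    qed
    then show ?thesis
      unfolding eq compatible_sum_def sum_distrib_left sum_distrib_right
      by (subst sum.reindex) (auto intro: inj_on_subset[OF inj] intro!: sum.cong)
  qed
  finally show ?thesis .
qed

text \<open>The diagonal obeys a recurrence of its own (\<open>perm_sum_diag\<close>). Setting it to
  0 removes the truncation \<open>min i n\<close> of the column range and lets shifted indices run
  over the edge.\<close>

definition perm_sum_below :: "'a::comm_semiring_1 \<Rightarrow> nat \<Rightarrow> nat \<Rightarrow> 'a" where
  "perm_sum_below q n i = (if 1 \<le> i \<and> i < n then perm_sum q n i else 0)"

lemma sum_perm_sum_below:
  "(\<Sum>j\<in>{1..min i n}. perm_sum q (Suc n) j) = (\<Sum>j\<in>{1..i}. perm_sum_below q (Suc n) j)"
  by (rule sum.mono_neutral_cong_left) (auto simp: perm_sum_below_def)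

lemma compatible_sum_Suc:
  assumes "n \<ge> 1" "1 \<le> i"
  shows "compatible_sum q (Suc n) i =
    (\<Sum>j\<in>{1..i}. perm_sum_below q (Suc n) j) + q * compatible_sum q n i"
  using sum_compatible_by_head[OF assms, of q "\<lambda>_. 1"]
  unfolding compatible_sum_def mult_1_right sum_perm_sum_below .

text \<open>The weight \<open>q\<close> for heads below \<open>i\<close> records the new descent;
  the head \<open>Suc n\<close> is not below \<open>i\<close> and receives weight 1.\<close>

lemma perm_sum_below_Suc:
  assumes "n \<ge> 1" "1 \<le> i" "i \<le> Suc n"
  shows "perm_sum_below q (Suc (Suc n)) i =
    q * (\<Sum>j\<in>{1..<i}. perm_sum_below q (Suc n) j) + perm_sum_below q (Suc n) i + q * compatible_sum q n i"
proof -
  have "perm_sum_below q (Suc (Suc n)) i =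
      (\<Sum>j \<in> {1..min i n}. perm_sum q (Suc n) j * (if j < i then q else 1)) + q * compatible_sum q n i"
    using perm_sum_Suc[of "Suc n" i q] sum_compatible_by_head[OF assms(1,2), of q "\<lambda>j. if j < i then q else 1"] assms
    by (simp add: perm_sum_below_def)
  also have "(\<Sum>j \<in> {1..min i n}. perm_sum q (Suc n) j * (if j < i then q else 1)) =
      (\<Sum>j \<in> {1..i}. perm_sum_below q (Suc n) j * (if j < i then q else 1))"
    by (rule sum.mono_neutral_cong_left) (auto simp: perm_sum_below_def)
  also have "{1..i} = insert i {1..<i}" using assms by auto
  also have "(\<Sum>j \<in> insert i {1..<i}. perm_sum_below q (Suc n) j * (if j < i then q else 1)) =
      q * (\<Sum>j\<in>{1..<i}. perm_sum_below q (Suc n) j) + perm_sum_below q (Suc n) i"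
    by (simp add: sum_distrib_left mult.commute add.commute)
  finally show ?thesis .
qed

lemma compatible_sum_eq_total:
  assumes "n \<ge> 1" "n \<le> i"
  shows "compatible_sum q n i = (\<Sum>j\<in>{1..n}. perm_sum q n j)"
proof -
  have heads: "(\<lambda>w. w ! 0) ` avoiding_perms n \<subseteq> {1..n}"
    using avoiding_permsD assms(1) by (metis image_subsetI nth_mem One_nat_def Suc_le_lessD)
  have "{w \<in> avoiding_perms n. compatible i w} = avoiding_perms n"
    using compatible_trivial assms(2) by auto
  then show ?thesis
    unfolding compatible_sum_def perm_sum_def
    using sum.group[OF finite_avoiding_perms _ heads, of "\<lambda>w. q ^ desc w"] by simp
qed

text \<open>A new maximum in front is always compatible and always starts a descent.\<close>

lemma perm_sum_diag:
  assumes "n \<ge> 1"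
  shows "perm_sum q (Suc n) (Suc n) = q * (\<Sum>j\<in>{1..n}. perm_sum q n j)"
proof -
  have "w ! 0 < Suc n" if "w \<in> avoiding_perms n" for w
    using avoiding_permsD[OF that] assms nth_mem[of 0 w] by auto
  then have "perm_sum q (Suc n) (Suc n) = q * compatible_sum q n (Suc n)"
    using assms by (subst perm_sum_Suc) (auto simp: compatible_sum_def sum_distrib_left mult.commute intro!: sum.cong)
  then show ?thesis using compatible_sum_eq_total[of n "Suc n" q] assms by simp
qed

lemma avoiding_perms_1: "avoiding_perms (Suc 0) = {[1]}"
  by (auto simp: avoiding_perms_altdef)

lemma compatible_sum_1: "1 \<le> i \<Longrightarrow> compatible_sum q (Suc 0) i = 1"
proof -
  assume "1 \<le> i"
  then have "{w \<in> {[1]}. compatible i w} = {[1]}" by (auto simp: compatible_def)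
  then show ?thesis unfolding compatible_sum_def avoiding_perms_1 by simp
qed

lemma perm_sum_1: "perm_sum q (Suc 0) (Suc 0) = 1"
proof -
  have "{w \<in> {[1]}. w ! 0 = Suc 0} = {[1]}" by auto
  then show ?thesis unfolding perm_sum_def avoiding_perms_1 by simp
qed

lemma perm_sum_2: "perm_sum q 2 1 = 1"
proof -
  have "{w \<in> {[1]}. compatible 1 w} = {[1]}" by (auto simp: compatible_def)
  then show ?thesis
    using perm_sum_Suc[of 1 1 q] by (simp add: avoiding_perms_1 numeral_2_eq_2)
qed

lemma conv_array_perm_sum: "conv_array q (perm_sum q)"
proof -
  let ?C = "conv_coeff q (perm_sum q)" and ?F = "perm_sum_below q" and ?E = "compatible_sum q"
  have F_0: "?F n i = 0" if "n \<le> i" for n i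
    using that by (simp add: perm_sum_below_def)
  have F_2: "?F 2 1 = 1" using perm_sum_2 by (simp add: perm_sum_below_def)
  \<comment> \<open>The recurrence at \<open>i = Suc m\<close> loses its middle term, as
    \<open>?F\<close> vanishes on the diagonal, and its last term is the diagonal value of
    \<open>perm_sum\<close>.\<close>
  have C: "?C n = perm_sum q (Suc n) n" if "n \<ge> 2" for n
  proof -
    from that obtain m where m: "n = Suc m" "m \<ge> 1" by (cases n) auto
    have "perm_sum q (Suc n) n = ?F (Suc (Suc m)) (Suc m)"
      using m by (simp add: perm_sum_below_def)
    also have "\<dots> = q * (\<Sum>j\<in>{1..<Suc m}. ?F (Suc m) j) + q * ?E m (Suc m)"
      using m by (subst perm_sum_below_Suc) (auto simp: F_0)
    also have "q * ?E m (Suc m) = perm_sum q n n"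
      using perm_sum_diag[of m q] compatible_sum_eq_total[of m "Suc m" q] m by simp
    also have "(\<Sum>j\<in>{1..<Suc m}. ?F (Suc m) j) = (\<Sum>j\<in>{1..<n}. perm_sum q n j)"
      using m by (intro sum.cong) (auto simp: perm_sum_below_def)
    finally show ?thesis using that by (simp add: conv_coeff_def)
  qed
  have conv: "?F (m + 2) i = (\<Sum>k\<in>{1..m}. ?C k * (if k \<le> i then ?F (m + 2 - k) (i + 1 - k) else 0)) +
      (if i = m + 1 then ?C (m + 1) else 0)" if "m \<ge> 1" "i \<ge> 1" for m i
  proof -
    have "?C n = ?F (Suc n) n" if "n \<ge> 2" for n
      using C[OF that] that by (simp add: perm_sum_below_def)
    moreover have "?C 1 = 1 + q" by (simp add: conv_coeff_def)
    ultimately have "(\<forall>i\<ge>1. ?F (m + 2) i =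
          (\<Sum>k\<in>{1..m}. ?C k * (if k \<le> i then ?F (m + 2 - k) (i + 1 - k) else 0)) +
            (if i = m + 1 then ?C (m + 1) else 0)) \<and>
         (\<forall>i\<ge>1. ?E (m + 1) i = (\<Sum>k\<in>{1..m}. ?C k * (if k \<le> i then ?E (m + 1 - k) (i + 1 - k) else 0)))"
      using that(1) perm_sum_below_Suc compatible_sum_Suc F_0 compatible_sum_1 F_2
      by (intro convolution_from_steps)
    then show ?thesis using that(2) by simp
  qed
  have "perm_sum q n i = (\<Sum>k\<in>{1..i}. ?C k * perm_sum q (n - k) (i + 1 - k))"
    if i: "1 \<le> i" "i + 2 \<le> n" for n i
  proof -
    have n: "n - 2 + 2 = n" using i by simp
    have "perm_sum q n i = ?F n i"
      using i by (simp add: perm_sum_below_def)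
    \<comment> \<open>The boundary term sits in column \<open>n - 1\<close>, beyond
      \<open>i \<le> n - 2\<close>.\<close>
    also have "\<dots> = (\<Sum>k\<in>{1..n - 2}. ?C k * (if k \<le> i then ?F (n - k) (i + 1 - k) else 0))"
      using conv[of "n - 2" i] i unfolding n by simp
    also have "\<dots> = (\<Sum>k\<in>{1..i}. ?C k * ?F (n - k) (i + 1 - k))"
      using i by (intro sum.mono_neutral_cong_right) auto
    \<comment> \<open>\<open>i + 1 - k < n - k\<close> keeps all entries off the diagonal.\<close>
    also have "\<dots> = (\<Sum>k\<in>{1..i}. ?C k * perm_sum q (n - k) (i + 1 - k))"
      using i by (intro sum.cong) (auto simp: perm_sum_below_def)
    finally show ?thesis .
  qed
  then show ?thesis
    unfolding conv_array_def using perm_sum_1[of q] perm_sum_2[of q] perm_sum_diag[of _ q] C by simp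
qed

section \<open>Cutting sequences at the last fixed point\<close>

text \<open>Formulated with values of a subsequence instead of positions, so that it passes directly
  to subsequences and translates.\<close>

definition steep :: "nat list \<Rightarrow> bool" where
  "steep e \<longleftrightarrow> \<not> (\<exists>a b c. subseq [a, b, c] e \<and> b \<le> a \<and> c < a)"

lemma subseq_3_nth_iff:
  "subseq [a, b, c] e \<longleftrightarrow> (\<exists>i j k. i < j \<and> j < k \<and> k < length e \<and> e ! i = a \<and> e ! j = b \<and> e ! k = c)"
    (is "?L \<longleftrightarrow> ?R")
proof
  assume ?L
  then obtain i j k where "i < length e" "e ! i = a"
    "j < length (drop (Suc i) e)" "drop (Suc i) e ! j = b"
    "k < length (drop (Suc j) (drop (Suc i) e))" "drop (Suc j) (drop (Suc i) e) ! k = c"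
    unfolding subseq_Cons_nth_iff by blast
  then show ?R
    by (intro exI[of _ i] exI[of _ "Suc i + j"] exI[of _ "Suc j + Suc i + k"]) (simp add: add_ac)
next
  assume ?R
  then obtain i j k where ijk: "i < j" "j < k" "k < length e" "e ! i = a" "e ! j = b" "e ! k = c"
    by blast
  then have "drop (Suc i) e ! (j - Suc i) = b" "drop (Suc (j - Suc i)) (drop (Suc i) e) ! (k - Suc j) = c"
    by simp_all
  then show ?L
    unfolding subseq_Cons_nth_iff using ijk
    by (intro exI[of _ i] conjI exI[of _ "j - Suc i"] exI[of _ "k - Suc j"]) auto
qed

lemma U_seqs_altdef:
  "U_seqs n = {e. length e = n \<and> (\<forall>k<n. 1 \<le> e ! k \<and> e ! k \<le> Suc k) \<and> steep e}"
proof -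
  have steep: "\<not> (\<exists>i j k. i < j \<and> j < k \<and> k < n \<and> e ! i \<ge> e ! j \<and> e ! i > e ! k) \<longleftrightarrow> steep e"
    if "length e = n" for e
    unfolding steep_def subseq_3_nth_iff that by blast
  show ?thesis unfolding U_seqs_def by (intro Collect_cong conj_cong refl steep)
qed

lemma steep_subseq: "steep e \<Longrightarrow> subseq e' e \<Longrightarrow> steep e'"
  unfolding steep_def by (meson subseq_order.order_trans)

lemma steep_map_add: "steep (map (\<lambda>x. x + d) e) \<longleftrightarrow> steep e"
proof -
  have "subseq [a + d, b + d, c + d] (map (\<lambda>x. x + d) e) \<longleftrightarrow> subseq [a, b, c] e" for a b c
    unfolding subseq_3_nth_iff by (intro iff_exI) (auto)
  moreover have "\<exists>a' b' c'. a = a' + d \<and> b = b' + d \<and> c = c' + d"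
    if "subseq [a, b, c] (map (\<lambda>x. x + d) e)" for a b c
    using that unfolding subseq_3_nth_iff by auto
  ultimately show ?thesis
    unfolding steep_def by (metis add_le_cancel_right add_less_cancel_right)
qed

lemma U_seqs_nth: "e \<in> U_seqs n \<Longrightarrow> k < n \<Longrightarrow> 1 \<le> e ! k \<and> e ! k \<le> Suc k"
  by (simp add: U_seqs_altdef)

lemma U_seqs_length: "e \<in> U_seqs n \<Longrightarrow> length e = n"
  by (simp add: U_seqs_altdef)

lemma U_seqs_set: "e \<in> U_seqs n \<Longrightarrow> set e \<subseteq> {1..n}"
  by (force simp: U_seqs_altdef in_set_conv_nth)

lemma U_seqs_hd: "e \<in> U_seqs n \<Longrightarrow> n \<ge> 1 \<Longrightarrow> \<exists>r. e = 1 # r"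
  using U_seqs_nth[of e n 0] U_seqs_length[of e n] by (cases e) auto

section \<open>The gluing bijection\<close>

text \<open>
  The parameter \<open>k\<close> becomes the last fixed point (in 1-based indexing) of \<open>glue k p f\<close>. The initial
  entry 1 of \<open>f\<close> is represented by \<open>k\<close> itself.
\<close>

definition glue :: "nat \<Rightarrow> nat list \<Rightarrow> nat list \<Rightarrow> nat list" where
  "glue k p f = butlast p @ [k, last p] @ map (\<lambda>x. x + (k - 1)) (tl f)"

lemma subseq_Cons_append:
  "a \<notin> set p \<Longrightarrow> subseq (a # ys) (p @ zs) \<longleftrightarrow> subseq (a # ys) zs"
  by (induction p) (auto simp: subseq_Cons_Cons_iff)

lemma subseq_set: "subseq xs ys \<Longrightarrow> set xs \<subseteq> set ys"
  by (metis notin_set_nthsI subseq_conv_nths subsetI)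

text \<open>A bad triple starting below \<open>k\<close> uses neither \<open>k\<close> nor an entry
  of \<open>r\<close>, so it lies in \<open>p @ [s]\<close>. One starting with a value at least
  \<open>k\<close> starts after \<open>p\<close>; its last entry lies in \<open>r\<close>, hence is
  at least \<open>k\<close>, so the first exceeds \<open>k\<close> and all three lie in
  \<open>r\<close>.\<close>

lemma steep_glue:
  assumes p: "steep (p @ [s])" "\<forall>x\<in>set p. x < k" "s \<le> k"
    and r: "steep r" "\<forall>x\<in>set r. k \<le> x"
  shows "steep (p @ [k, s] @ r)"
  unfolding steep_def
proof (intro notI, elim exE conjE)
  fix a b c assume sub: "subseq [a, b, c] (p @ [k, s] @ r)" and le: "b \<le> a" "c < a"
  show False
  proof (cases "a < k")
    case True
    have "filter (\<lambda>x. x < k) r = []" using r(2) by (auto simp: filter_empty_conv)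
    then have "filter (\<lambda>x. x < k) (p @ [k, s] @ r) = filter (\<lambda>x. x < k) (p @ [s])" by simp
    moreover have "subseq [a, b, c] (filter (\<lambda>x. x < k) (p @ [k, s] @ r))"
      unfolding subseq_filter_iff using sub True le by auto
    ultimately have "subseq [a, b, c] (filter (\<lambda>x. x < k) (p @ [s]))" by simp
    then have "subseq [a, b, c] (p @ [s])" unfolding subseq_filter_iff ..
    then show False using p(1) le unfolding steep_def by blast
  next
    case False
    then have "a \<notin> set p" using p(2) by auto
    then have "subseq [a, b, c] (k # s # r)" using sub by (simp add: subseq_Cons_append)
    moreover have "c \<in> set r \<Longrightarrow> a > k" using r(2) le by auto
    moreover have "subseq [b, c] r \<Longrightarrow> c \<in> set r" using subseq_set by fastforce
    ultimately have "subseq [a, b, c] r"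
      using p(3) unfolding subseq_Cons_Cons_iff[of a _ k] subseq_Cons_Cons_iff[of _ _ s]
        subseq_singleton_left by auto
    then show False using r(1) le unfolding steep_def by blast
  qed
qed

text \<open>The entries of \<open>u\<close> stand before position \<open>k\<close> and do not exceed
  their position, hence are below \<open>k\<close>.\<close>

lemma glue_decomp:
  assumes "p \<in> U_seqs k" "f \<in> U_seqs l" "k \<ge> 1" "l \<ge> 1"
  obtains u s r where "p = u @ [s]" "f = 1 # r" "length u = k - 1" "length r = l - 1"
    "glue k p f = u @ [k, s] @ map (\<lambda>x. x + (k - 1)) r" "\<forall>x\<in>set u. x < k" "1 \<le> s" "s \<le> k"
    "\<forall>x\<in>set r. 1 \<le> x"
proof -
  from assms obtain r where r: "f = 1 # r" using U_seqs_hd by blast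
  from assms have "p \<noteq> []" using U_seqs_length[of p k] by auto
  then obtain u s where us: "p = u @ [s]" by (metis append_butlast_last_id)
  have len: "length u = k - 1" using U_seqs_length[OF assms(1)] us by simp
  have "x < k" if "x \<in> set u" for x
  proof -
    from that obtain i where "i < length u" "x = u ! i" by (auto simp: in_set_conv_nth)
    moreover from this len have "i < k" by simp
    ultimately show ?thesis using U_seqs_nth[OF assms(1) \<open>i < k\<close>] us len by (auto simp: nth_append)
  qed
  moreover have "1 \<le> s \<and> s \<le> k" using U_seqs_set[OF assms(1)] us by auto
  moreover have "\<forall>x\<in>set r. 1 \<le> x" using U_seqs_set[OF assms(2)] r by auto
  ultimately show ?thesis
    using that us r len U_seqs_length[OF assms(2)] by (simp add: glue_def)
qed

text \<open>In 0-based indexing, the second and third claims say that position \<open>k\<close>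
  holds a fixed point and that no later position does.\<close>

lemma glue_in_U_seqs:
  assumes "p \<in> U_seqs k" "f \<in> U_seqs l" "k \<ge> 1" "l \<ge> 1"
  shows "glue k p f \<in> U_seqs (k + l)" "glue k p f ! (k - 1) = k"
    "\<And>j. k \<le> j \<Longrightarrow> j < k + l \<Longrightarrow> glue k p f ! j \<le> j"
proof -
  obtain u s r where d: "p = u @ [s]" "f = 1 # r" "length u = k - 1" "length r = l - 1"
    "glue k p f = u @ [k, s] @ map (\<lambda>x. x + (k - 1)) r" "\<forall>x\<in>set u. x < k" "1 \<le> s" "s \<le> k"
    "\<forall>x\<in>set r. 1 \<le> x"
    using glue_decomp[OF assms] .
  \<comment> \<open>\<open>r ! j\<close> is \<open>f ! Suc j\<close>, whence the bound
    \<open>j + 2\<close>.\<close>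
  have nth_r: "1 \<le> r ! j \<and> r ! j \<le> j + 2" if "j < l - 1" for j
    using U_seqs_nth[OF assms(2), of "Suc j"] that d(2) by simp
  have nth_u: "1 \<le> u ! j \<and> u ! j \<le> Suc j" if "j < k - 1" for j
    using U_seqs_nth[OF assms(1), of j] that d(1,3) by (simp add: nth_append)
  show at_k: "glue k p f ! (k - 1) = k"
    unfolding d(5) using d(3) by (simp add: nth_append)
  have nth_glue: "glue k p f ! j = (if j < k - 1 then u ! j else if j = k - 1 then k else if j = k then s
      else r ! (j - k - 1) + (k - 1))" if "j < k + l" for j
  proof -
    consider "j < k - 1" | "j = k - 1" | "j = k" | i where "j = Suc k + i"
      using less_imp_Suc_add[of k j] by fastforce
    then show ?thesis
      by cases (use d(3,4) that assms(3) in \<open>auto simp add: d(5) nth_append\<close>)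
  qed
  have nth_shifted: "1 \<le> r ! (j - k - 1) + (k - 1) \<and> r ! (j - k - 1) + (k - 1) \<le> j"
    if "k < j" "j < k + l" for j
  proof -
    have "j - k - 1 < l - 1" using that by linarith
    from nth_r[OF this] show ?thesis using that(1) assms(3) by linarith
  qed
  show "glue k p f ! j \<le> j" if "k \<le> j" "j < k + l" for j
    using that nth_glue[OF that(2)] nth_shifted[of j] d(8) assms(3) by (cases "j = k") auto
  have "1 \<le> glue k p f ! j \<and> glue k p f ! j \<le> Suc j" if j: "j < k + l" for j
  proof -
    consider "j < k - 1" | "j = k - 1" | "j = k" "k - 1 < j" | "k < j"
      using assms(3) by linarith
    then show ?thesis
    proof cases
      case 1
      then show ?thesis using nth_glue[OF j] nth_u[of j] by simp
    next
      case 2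
      then show ?thesis using at_k assms(3) by simp
    next
      case 3
      then show ?thesis using nth_glue[OF j] d(7,8) by auto
    next
      case 4
      then show ?thesis using nth_glue[OF j] nth_shifted[of j] j by auto
    qed
  qed
  moreover have "steep (glue k p f)"
    unfolding d(5)
  proof (rule steep_glue)
    have "steep r" using assms(2) d(2) by (auto simp: U_seqs_altdef intro: steep_subseq)
    then show "steep (map (\<lambda>x. x + (k - 1)) r)" by (simp add: steep_map_add)
    show "\<forall>x\<in>set (map (\<lambda>x. x + (k - 1)) r). k \<le> x" using d(9) by auto
    show "steep (u @ [s])" using assms(1) d(1) by (simp add: U_seqs_altdef)
  qed (use d in auto)
  moreover have "length (glue k p f) = k + l"
    unfolding d(5) using d(3,4) assms(3,4) by simp
  ultimately show "glue k p f \<in> U_seqs (k + l)" by (simp add: U_seqs_altdef)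
qed

text \<open>\<open>k\<close> can be read off as the last fixed point; then the pieces have known
  lengths and can be compared.\<close>

lemma glue_inject:
  assumes "p \<in> U_seqs k" "f \<in> U_seqs l" "k \<ge> 1" "l \<ge> 1"
    "p' \<in> U_seqs k'" "f' \<in> U_seqs l'" "k' \<ge> 1" "l' \<ge> 1"
    "k + l = k' + l'" "glue k p f = glue k' p' f'"
  shows "k = k' \<and> p = p' \<and> f = f'"
proof -
  have "k = k'"
  proof (rule ccontr)
    assume "k \<noteq> k'"
    then consider "k < k'" | "k' < k" by linarith
    then show False
    proof cases
      case 1
      then show False
        using glue_in_U_seqs(2)[OF assms(5-8)] glue_in_U_seqs(3)[OF assms(1-4), of "k' - 1"] assms(7-10) by force
    next
      case 2
      then show False
        using glue_in_U_seqs(2)[OF assms(1-4)] glue_in_U_seqs(3)[OF assms(5-8), of "k - 1"] assms(3,4,9,10) by force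
    qed
  qed
  obtain u s r where d: "p = u @ [s]" "f = 1 # r" "length u = k - 1"
    "glue k p f = u @ [k, s] @ map (\<lambda>x. x + (k - 1)) r"
    by (rule glue_decomp[OF assms(1-4)])
  obtain u' s' r' where d': "p' = u' @ [s']" "f' = 1 # r'" "length u' = k' - 1"
    "glue k' p' f' = u' @ [k', s'] @ map (\<lambda>x. x + (k' - 1)) r'"
    by (rule glue_decomp[OF assms(5-8)])
  have "u @ [k, s] @ map (\<lambda>x. x + (k - 1)) r = u' @ [k', s'] @ map (\<lambda>x. x + (k' - 1)) r'"
    using assms(10) unfolding d(4) d'(4) .
  then have "u = u' \<and> s = s' \<and> map (\<lambda>x. x + (k - 1)) r = map (\<lambda>x. x + (k - 1)) r'"
    using d(3) d'(3) \<open>k = k'\<close> by simp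
  moreover have "inj (\<lambda>x. x + (k - 1))" by (simp add: inj_def)
  ultimately show ?thesis
    using \<open>k = k'\<close> d(1,2) d'(1,2) by (simp add: inj_map_eq_map)
qed

lemma glue_surj:
  assumes e: "e \<in> U_seqs n" and n: "n \<ge> 1" and last: "last e \<noteq> n"
  shows "\<exists>k p f. k \<in> {1..<n} \<and> p \<in> U_seqs k \<and> f \<in> U_seqs (n - k) \<and> e = glue k p f"
proof -
  \<comment> \<open>The fixed points, counted from 1. The first entry is 1, so 1 belongs to the set;
    \<open>n\<close> is excluded by \<open>last e \<noteq> n\<close>.\<close>
  define K where "K = {k. 1 \<le> k \<and> k \<le> n \<and> e ! (k - 1) = k}"
  define k where "k = Max K"
  have "finite K" unfolding K_def by (rule finite_subset[of _ "{..n}"]) auto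
  moreover have "1 \<in> K" using U_seqs_nth[OF e, of 0] n by (auto simp: K_def)
  ultimately have "k \<in> K" and k_max: "\<And>j. j \<in> K \<Longrightarrow> j \<le> k"
    unfolding k_def by (auto intro: Max_in)
  have len: "length e = n" using U_seqs_length[OF e] .
  then have "last e = e ! (n - 1)" using n by (subst last_conv_nth) auto
  then have k: "1 \<le> k" "k < n" "e ! (k - 1) = k"
    using \<open>k \<in> K\<close> last by (auto simp: K_def le_less)
  have upper: "e ! j \<le> j" if "k \<le> j" "j < n" for j
    using U_seqs_nth[OF e that(2)] k_max[of "Suc j"] that by (force simp: K_def)
  have steep: "steep e" using e by (simp add: U_seqs_altdef)
  \<comment> \<open>Position \<open>k + 1\<close> is no fixed point, so its entry is at most
    \<open>k\<close>; after the entry \<open>k\<close> and this one, steepness forbids any value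
    below \<open>k\<close>.\<close>
  have lower: "k \<le> e ! j" if "k < j" "j < n" for j
  proof (rule ccontr)
    assume "\<not> k \<le> e ! j"
    have "subseq [e ! (k - 1), e ! k, e ! j] e"
      unfolding subseq_3_nth_iff using that k len
      by (intro exI[of _ "k - 1"] exI[of _ k] exI[of _ j]) auto
    then have "\<not> (e ! k \<le> e ! (k - 1) \<and> e ! j < e ! (k - 1))"
      using steep unfolding steep_def by blast
    then show False using \<open>\<not> k \<le> e ! j\<close> upper[of k] k by simp
  qed
  define u where "u = take (k - 1) e"
  define s where "s = e ! k"
  \<comment> \<open>Truncated subtraction is harmless, since the entries after position
    \<open>k + 1\<close> are at least \<open>k\<close>.\<close>
  define r where "r = map (\<lambda>x. x - (k - 1)) (drop (Suc k) e)"
  have map_r: "map (\<lambda>x. x + (k - 1)) r = drop (Suc k) e"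
    unfolding r_def map_map
  proof (rule map_idI)
    fix x assume "x \<in> set (drop (Suc k) e)"
    then obtain i where "i < n - Suc k" "x = e ! (Suc k + i)"
      using len k by (auto simp: in_set_conv_nth)
    then have "k \<le> x" using lower[of "Suc k + i"] by simp
    then show "((\<lambda>x. x + (k - 1)) \<circ> (\<lambda>x. x - (k - 1))) x = x" by simp
  qed
  have "e = u @ drop (k - 1) e" unfolding u_def by simp
  also have "drop (k - 1) e = k # drop k e"
    using k len Cons_nth_drop_Suc[of "k - 1" e] by simp
  also have "drop k e = s # drop (Suc k) e"
    unfolding s_def using k len by (simp add: Cons_nth_drop_Suc)
  finally have e_eq: "e = u @ [k, s] @ map (\<lambda>x. x + (k - 1)) r" unfolding map_r by simp
  have "u @ [s] \<in> U_seqs k"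
  proof -
    have "subseq (u @ [s]) e" by (subst e_eq) (auto intro!: list_emb_append_mono)
    then have "steep (u @ [s])" using steep steep_subseq by blast
    moreover have "length u = k - 1" using k len by (simp add: u_def)
    moreover have "1 \<le> u ! j \<and> u ! j \<le> Suc j" if "j < k - 1" for j
      using U_seqs_nth[OF e, of j] that k by (simp add: u_def)
    moreover have "1 \<le> s \<and> s \<le> k"
      using U_seqs_nth[OF e, of k] upper[of k] k by (simp add: s_def)
    ultimately show ?thesis
      using k by (auto simp: U_seqs_altdef nth_append)
  qed
  moreover have "1 # r \<in> U_seqs (n - k)"
  proof -
    \<comment> \<open>The fixed point \<open>k\<close> plays the role of the initial 1; skipping
      \<open>s\<close> leaves a subsequence of \<open>e\<close>.\<close>
    have "map (\<lambda>x. x + (k - 1)) (1 # r) = [k] @ map (\<lambda>x. x + (k - 1)) r" using k by simp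
    moreover have "subseq \<dots> e"
      by (subst e_eq, rule subseq_drop_many) (auto intro: list_emb_Cons)
    ultimately have "steep (1 # r)" using steep steep_subseq steep_map_add by metis
    moreover have "length (1 # r) = n - k" using k len by (simp add: r_def)
    moreover have "1 \<le> (1 # r) ! j \<and> (1 # r) ! j \<le> Suc j" if "j < n - k" for j
    proof (cases j)
      case (Suc i)
      have "Suc k \<le> length e" using k len by simp
      then have "drop (Suc k) e ! i = e ! (k + j)" using Suc by (subst nth_drop) auto
      then have "r ! i = e ! (k + j) - (k - 1)" using Suc that len by (simp add: r_def)
      moreover have "k < k + j" "k \<le> k + j" "k + j < n" using Suc that by linarith+
      then have "k \<le> e ! (k + j)" "e ! (k + j) \<le> k + j" using lower upper by blast+
      ultimately have "1 \<le> r ! i \<and> r ! i \<le> Suc j" using k by linarith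
      then show ?thesis using Suc by simp
    qed simp
    ultimately show ?thesis by (simp add: U_seqs_altdef)
  qed
  moreover have "e = glue k (u @ [s]) (1 # r)" using e_eq by (simp add: glue_def)
  ultimately show ?thesis using k by (metis atLeastLessThan_iff)
qed

section \<open>Weighted sums by last entry\<close>

definition U_sum :: "'a::comm_semiring_1 \<Rightarrow> nat \<Rightarrow> nat \<Rightarrow> 'a" where
  "U_sum q n i = (\<Sum>e \<in> {e \<in> U_seqs n. last e = i}. q ^ (num_distinct e - 1))"

text \<open>Inserting \<open>k\<close> before the last entry of \<open>p\<close> adds a new value unless that last entry is \<open>k\<close>.\<close>

definition prefix_weight :: "'a::comm_semiring_1 \<Rightarrow> nat \<Rightarrow> nat list \<Rightarrow> 'a" where
  "prefix_weight q k p = (if last p = k then 1 else q) * q ^ (num_distinct p - 1)"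

text \<open>The values of \<open>p\<close> other than \<open>k\<close> are below \<open>k\<close>,
  those of the shifted \<open>f\<close> are at least \<open>k\<close>, and \<open>k\<close> itself
  is the shifted initial 1 of \<open>f\<close>. So the counts add up once \<open>k\<close> is
  removed from \<open>p\<close>, where it can occur only as the last entry.\<close>

lemma glue_weight:
  assumes "p \<in> U_seqs k" "f \<in> U_seqs l" "k \<ge> 1" "l \<ge> 1"
  shows "q ^ (num_distinct (glue k p f) - 1) = prefix_weight q k p * q ^ (num_distinct f - 1)"
proof -
  obtain u s r where d: "p = u @ [s]" "f = 1 # r" "length u = k - 1" "length r = l - 1"
    "glue k p f = u @ [k, s] @ map (\<lambda>x. x + (k - 1)) r" "\<forall>x\<in>set u. x < k" "1 \<le> s" "s \<le> k"
    "\<forall>x\<in>set r. 1 \<le> x"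
    using glue_decomp[OF assms] .
  let ?g = "\<lambda>x. x + (k - 1)"
  have inj: "inj_on ?g A" for A by (simp add: inj_on_def)
  have "set (glue k p f) = (set p - {k}) \<union> ?g ` set f"
    unfolding d(5) unfolding d(1,2) using d(6) assms(3) by auto
  moreover have "(set p - {k}) \<inter> ?g ` set f = {}"
    unfolding d(1,2) using d(6,8,9) assms(3) by fastforce
  ultimately have "num_distinct (glue k p f) = card (set p - {k}) + num_distinct f"
    unfolding num_distinct_def by (simp add: card_Un_disjoint card_image inj)
  moreover have "num_distinct f \<ge> 1"
    unfolding num_distinct_def d(2) by (simp add: card_gt_0_iff Suc_le_eq)
  moreover have "card (set p - {k}) = (if s = k then card (set p) - 1 else card (set p))"
  proof -
    have "k \<in> set p \<longleftrightarrow> s = k" using d(1,6) by auto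
    then show ?thesis by simp
  qed
  moreover have "card (set p) \<ge> 1" unfolding d(1) by (simp add: card_gt_0_iff Suc_le_eq)
  ultimately have "num_distinct (glue k p f) - 1 =
      (if s = k then 0 else 1) + (num_distinct p - 1) + (num_distinct f - 1)"
    by (simp add: num_distinct_def)
  then show ?thesis
    by (simp add: prefix_weight_def d(1) power_add)
qed

lemma glue_last:
  assumes "p \<in> U_seqs k" "f \<in> U_seqs l" "k \<ge> 1" "l \<ge> 1"
  shows "last (glue k p f) = (if l = 1 then last p else last f + (k - 1))"
proof -
  obtain u s r where d: "p = u @ [s]" "f = 1 # r" "length u = k - 1" "length r = l - 1"
    "glue k p f = u @ [k, s] @ map (\<lambda>x. x + (k - 1)) r" "\<forall>x\<in>set u. x < k" "1 \<le> s" "s \<le> k"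
    "\<forall>x\<in>set r. 1 \<le> x"
    using glue_decomp[OF assms] .
  show ?thesis
  proof (cases "l = 1")
    case True
    then show ?thesis using d(4) unfolding d(5) unfolding d(1,2) by simp
  next
    case False
    then have "r \<noteq> []" using d(4) assms(4) by auto
    then show ?thesis using False unfolding d(5) unfolding d(1,2) by (simp add: last_map)
  qed
qed

text \<open>\<open>glue\<close> is a bijection onto the sequences not ending in \<open>n\<close>.
  The function \<open>h\<close> is 1 for totals and an indicator for a prescribed last
  entry.\<close>

lemma sum_U_seqs_glue:
  assumes "n \<ge> 1"
  shows "(\<Sum>e \<in> {e \<in> U_seqs n. last e \<noteq> n}. q ^ (num_distinct e - 1) * h (last e)) =
    (\<Sum>k\<in>{1..<n}. \<Sum>p\<in>U_seqs k. \<Sum>f\<in>U_seqs (n - k).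
       prefix_weight q k p * q ^ (num_distinct f - 1) *
       h (if n - k = 1 then last p else last f + (k - 1)))"
    (is "?L = ?R")
proof -
  let ?T = "Sigma {1..<n} (\<lambda>k. U_seqs k \<times> U_seqs (n - k))"
  let ?g = "\<lambda>(k, p, f). glue k p f"
  have inj: "inj_on ?g ?T"
  proof (rule inj_onI)
    fix t t' assume "t \<in> ?T" "t' \<in> ?T" and eq: "?g t = ?g t'"
    then obtain k p f k' p' f' where t: "t = (k, p, f)" "t' = (k', p', f')"
      and *: "1 \<le> k" "k < n" "p \<in> U_seqs k" "f \<in> U_seqs (n - k)"
        "1 \<le> k'" "k' < n" "p' \<in> U_seqs k'" "f' \<in> U_seqs (n - k')"
      by auto
    have "k = k' \<and> p = p' \<and> f = f'"
      by (rule glue_inject[where l = "n - k" and l' = "n - k'"]) (use * eq t in auto)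
    then show "t = t'" using t by simp
  qed
  have image: "?g ` ?T = {e \<in> U_seqs n. last e \<noteq> n}"
  proof
    show "?g ` ?T \<subseteq> {e \<in> U_seqs n. last e \<noteq> n}"
    proof
      fix e assume "e \<in> ?g ` ?T"
      then obtain k p f where *: "1 \<le> k" "k < n" "p \<in> U_seqs k" "f \<in> U_seqs (n - k)"
        and e: "e = glue k p f"
        by auto
      then have g: "e \<in> U_seqs n" "e ! (n - 1) \<le> n - 1"
        using glue_in_U_seqs(1)[of p k f "n - k"] glue_in_U_seqs(3)[of p k f "n - k" "n - 1"] by auto
      moreover have "last e = e ! (n - 1)"
        using U_seqs_length[OF g(1)] * by (subst last_conv_nth) auto
      ultimately show "e \<in> {e \<in> U_seqs n. last e \<noteq> n}" using * by simp
    qed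
    show "{e \<in> U_seqs n. last e \<noteq> n} \<subseteq> ?g ` ?T"
    proof clarify
      fix e assume "e \<in> U_seqs n" "last e \<noteq> n"
      then obtain k p f where "k \<in> {1..<n}" "p \<in> U_seqs k" "f \<in> U_seqs (n - k)" "e = glue k p f"
        using glue_surj[of e n] assms by blast
      then show "e \<in> ?g ` ?T" by (intro image_eqI[of _ _ "(k, p, f)"]) auto
    qed
  qed
  have "?L = (\<Sum>(k, p, f)\<in>?T. prefix_weight q k p * q ^ (num_distinct f - 1) *
       h (if n - k = 1 then last p else last f + (k - 1)))"
    unfolding image[symmetric] sum.reindex[OF inj]
  proof (rule sum.cong[OF refl])
    fix t assume "t \<in> ?T"
    then obtain k p f where t: "t = (k, p, f)"
      and *: "1 \<le> k" "k < n" "p \<in> U_seqs k" "f \<in> U_seqs (n - k)"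
      by auto
    have l: "1 \<le> n - k" using * by simp
    show "((\<lambda>e. q ^ (num_distinct e - 1) * h (last e)) \<circ> ?g) t =
      (case t of (k, p, f) \<Rightarrow> prefix_weight q k p * q ^ (num_distinct f - 1) *
        h (if n - k = 1 then last p else last f + (k - 1)))"
      unfolding t comp_def prod.case glue_weight[OF *(3,4,1) l] glue_last[OF *(3,4,1) l] ..
  qed
  also have "\<dots> = ?R"
    by (subst sum.Sigma[symmetric]) (auto simp: finite_U_seqs sum.cartesian_product intro!: sum.cong)
  finally show ?thesis .
qed

lemma U_seqs_last: "e \<in> U_seqs n \<Longrightarrow> n \<ge> 1 \<Longrightarrow> last e \<in> {1..n}"
  using U_seqs_set[of e n] U_seqs_length[of e n] by (metis last_in_set list.size(3) not_one_le_zero subsetD)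

lemma sum_U_seqs_by_last:
  assumes "n \<ge> 1"
  shows "(\<Sum>e\<in>U_seqs n. q ^ (num_distinct e - 1)) = (\<Sum>i\<in>{1..n}. U_sum q n i)"
    and "(\<Sum>e\<in>{e \<in> U_seqs n. last e \<noteq> n}. q ^ (num_distinct e - 1)) = (\<Sum>i\<in>{1..<n}. U_sum q n i)"
proof -
  show "(\<Sum>e\<in>U_seqs n. q ^ (num_distinct e - 1)) = (\<Sum>i\<in>{1..n}. U_sum q n i)"
    unfolding U_sum_def
    by (rule sum.group[symmetric]) (use U_seqs_last assms in \<open>auto simp: finite_U_seqs\<close>)
  have "(\<Sum>e\<in>{e \<in> U_seqs n. last e \<noteq> n}. q ^ (num_distinct e - 1)) =
      (\<Sum>i\<in>{1..<n}. \<Sum>e \<in> {e \<in> {e \<in> U_seqs n. last e \<noteq> n}. last e = i}. q ^ (num_distinct e - 1))"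
    by (rule sum.group[symmetric]) (use U_seqs_last assms in \<open>fastforce simp: finite_U_seqs le_less\<close>)+
  also have "\<dots> = (\<Sum>i\<in>{1..<n}. U_sum q n i)"
    unfolding U_sum_def by (intro sum.cong refl) auto
  finally show "(\<Sum>e\<in>{e \<in> U_seqs n. last e \<noteq> n}. q ^ (num_distinct e - 1)) = (\<Sum>i\<in>{1..<n}. U_sum q n i)" .
qed

text \<open>Agrees with \<open>conv_coeff q (U_sum q) k\<close> for \<open>k \<ge> 2\<close> but
  equals 1 for \<open>k = 1\<close>.\<close>

definition prefix_coeff :: "'a::comm_semiring_1 \<Rightarrow> nat \<Rightarrow> 'a" where
  "prefix_coeff q k = (\<Sum>p\<in>U_seqs k. prefix_weight q k p)"

lemma prefix_coeff_eq:
  assumes "k \<ge> 1"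
  shows "prefix_coeff q k = q * (\<Sum>i\<in>{1..<k}. U_sum q k i) + U_sum q k k"
proof -
  have "prefix_coeff q k = (\<Sum>p\<in>{p \<in> U_seqs k. last p \<noteq> k}. prefix_weight q k p) +
      (\<Sum>p\<in>{p \<in> U_seqs k. last p = k}. prefix_weight q k p)"
    unfolding prefix_coeff_def
    by (subst sum.union_disjoint[symmetric]) (auto simp: finite_U_seqs intro!: sum.cong)
  also have "(\<Sum>p\<in>{p \<in> U_seqs k. last p = k}. prefix_weight q k p) = U_sum q k k"
    unfolding U_sum_def by (intro sum.cong) (auto simp: prefix_weight_def)
  also have "(\<Sum>p\<in>{p \<in> U_seqs k. last p \<noteq> k}. prefix_weight q k p) =
      q * (\<Sum>e\<in>{e \<in> U_seqs k. last e \<noteq> k}. q ^ (num_distinct e - 1))"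
    unfolding sum_distrib_left by (intro sum.cong) (auto simp: prefix_weight_def)
  finally show ?thesis unfolding sum_U_seqs_by_last(2)[OF assms] .
qed

lemma U_seqs_1: "U_seqs (Suc 0) = {[1]}"
proof -
  have "steep [1]" by (auto simp: steep_def subseq_3_nth_iff)
  then show ?thesis
    unfolding U_seqs_altdef by (auto simp: length_Suc_conv)
qed

lemma U_sum_1: "U_sum q (Suc 0) (Suc 0) = 1"
proof -
  have "{e \<in> {[1]}. last e = Suc 0} = {[1]}" by auto
  then show ?thesis unfolding U_sum_def U_seqs_1 by (simp add: num_distinct_def)
qed

lemma U_total_below:
  assumes "n \<ge> 1"
  shows "(\<Sum>i\<in>{1..<n}. U_sum q n i) =
    (\<Sum>k\<in>{1..<n}. prefix_coeff q k * (\<Sum>i\<in>{1..n - k}. U_sum q (n - k) i))"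
proof -
  have "(\<Sum>i\<in>{1..<n}. U_sum q n i) =
      (\<Sum>k\<in>{1..<n}. \<Sum>p\<in>U_seqs k. \<Sum>f\<in>U_seqs (n - k). prefix_weight q k p * q ^ (num_distinct f - 1))"
    using sum_U_seqs_glue[OF assms, of q "\<lambda>_. 1"]
    unfolding mult_1_right sum_U_seqs_by_last(2)[OF assms] .
  also have "\<dots> = (\<Sum>k\<in>{1..<n}. prefix_coeff q k * (\<Sum>i\<in>{1..n - k}. U_sum q (n - k) i))"
  proof (rule sum.cong[OF refl])
    fix k assume "k \<in> {1..<n}"
    then have "1 \<le> n - k" by auto
    then show "(\<Sum>p\<in>U_seqs k. \<Sum>f\<in>U_seqs (n - k). prefix_weight q k p * q ^ (num_distinct f - 1)) =
        prefix_coeff q k * (\<Sum>i\<in>{1..n - k}. U_sum q (n - k) i)"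
      by (simp only: prefix_coeff_def sum_product flip: sum_U_seqs_by_last(1))
  qed
  finally show ?thesis .
qed

text \<open>The cut \<open>k = n - 1\<close> is kept apart: there \<open>f = [1]\<close>, and the
  last entry is that of \<open>p\<close>. For smaller \<open>k\<close> the last entry depends on
  \<open>f\<close> alone, which lets the sum over \<open>p\<close> factor out.\<close>

lemma U_sum_below:
  assumes "1 \<le> i" "i < n"
  shows "U_sum q n i =
    (\<Sum>k\<in>{1..<n - 1}. prefix_coeff q k * (if k \<le> i then U_sum q (n - k) (i + 1 - k) else 0)) +
    (if i = n - 1 then 1 else q) * U_sum q (n - 1) i"
proof -
  have n: "n \<ge> 1" "{1..<n} = insert (n - 1) {1..<n - 1}" using assms by auto
  have "U_sum q n i =
      (\<Sum>e\<in>{e \<in> U_seqs n. last e \<noteq> n}. q ^ (num_distinct e - 1) * (if last e = i then 1 else 0))"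
    unfolding U_sum_def
    by (rule sum.mono_neutral_cong_left) (use assms in \<open>auto simp: finite_U_seqs\<close>)
  also have "\<dots> = (\<Sum>k\<in>{1..<n}. \<Sum>p\<in>U_seqs k. \<Sum>f\<in>U_seqs (n - k).
       prefix_weight q k p * q ^ (num_distinct f - 1) *
       (if (if n - k = 1 then last p else last f + (k - 1)) = i then 1 else 0))"
    by (rule sum_U_seqs_glue[OF n(1)])
  also have "\<dots> = (\<Sum>k\<in>{1..<n - 1}. \<Sum>p\<in>U_seqs k. \<Sum>f\<in>U_seqs (n - k).
       prefix_weight q k p * q ^ (num_distinct f - 1) *
       (if (if n - k = 1 then last p else last f + (k - 1)) = i then 1 else 0)) +
       (\<Sum>p\<in>U_seqs (n - 1). prefix_weight q (n - 1) p * (if last p = i then 1 else 0))"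
    unfolding n(2) using assms by (simp add: U_seqs_1 num_distinct_def add.commute)
  also have "(\<Sum>p\<in>U_seqs (n - 1). prefix_weight q (n - 1) p * (if last p = i then 1 else 0)) =
      (\<Sum>p\<in>{p \<in> U_seqs (n - 1). last p = i}. (if i = n - 1 then 1 else q) * q ^ (num_distinct p - 1))"
    by (rule sum.mono_neutral_cong_right) (auto simp: finite_U_seqs prefix_weight_def)
  also have "\<dots> = (if i = n - 1 then 1 else q) * U_sum q (n - 1) i"
    unfolding U_sum_def sum_distrib_left ..
  also have "(\<Sum>k\<in>{1..<n - 1}. \<Sum>p\<in>U_seqs k. \<Sum>f\<in>U_seqs (n - k).
       prefix_weight q k p * q ^ (num_distinct f - 1) *
       (if (if n - k = 1 then last p else last f + (k - 1)) = i then 1 else 0)) =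
     (\<Sum>k\<in>{1..<n - 1}. prefix_coeff q k * (if k \<le> i then U_sum q (n - k) (i + 1 - k) else 0))"
  proof (rule sum.cong[OF refl])
    fix k assume k: "k \<in> {1..<n - 1}"
    have "(\<Sum>f\<in>U_seqs (n - k). q ^ (num_distinct f - 1) * (if last f + (k - 1) = i then 1 else 0)) =
        (if k \<le> i then U_sum q (n - k) (i + 1 - k) else 0)"
    proof (cases "k \<le> i")
      case True
      then have "last f + (k - 1) = i \<longleftrightarrow> last f = i + 1 - k" for f using k by auto
      then have "(\<Sum>f\<in>U_seqs (n - k). q ^ (num_distinct f - 1) * (if last f + (k - 1) = i then 1 else 0)) =
          (\<Sum>f\<in>U_seqs (n - k). q ^ (num_distinct f - 1) * (if last f = i + 1 - k then 1 else 0))"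
        by (simp only:)
      also have "\<dots> = U_sum q (n - k) (i + 1 - k)"
        unfolding U_sum_def by (rule sum.mono_neutral_cong_right) (auto simp: finite_U_seqs)
      finally show ?thesis using True by simp
    next
      case False
      \<comment> \<open>The shifted last entry is at least \<open>k\<close>, hence above
        \<open>i\<close>.\<close>
      have "last f + (k - 1) \<noteq> i" if "f \<in> U_seqs (n - k)" for f
        using U_seqs_last[OF that] False k by fastforce
      then show ?thesis using False by simp
    qed
    moreover have "n - k \<noteq> 1" using k by auto
    ultimately show "(\<Sum>p\<in>U_seqs k. \<Sum>f\<in>U_seqs (n - k).
       prefix_weight q k p * q ^ (num_distinct f - 1) *
       (if (if n - k = 1 then last p else last f + (k - 1)) = i then 1 else 0)) =
       prefix_coeff q k * (if k \<le> i then U_sum q (n - k) (i + 1 - k) else 0)"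
      unfolding prefix_coeff_def sum_product by (simp add: sum_distrib_left[symmetric] sum_distrib_right mult.assoc)
  qed
  finally show ?thesis .
qed

text \<open>\<open>Suc n\<close> exceeds all entries of a sequence of length \<open>n\<close>, so it
  can be appended to any of them and adds one new value.\<close>

lemma U_sum_diag:
  assumes "n \<ge> 1"
  shows "U_sum q (Suc n) (Suc n) = q * (\<Sum>i\<in>{1..n}. U_sum q n i)"
proof -
  have "{e \<in> U_seqs (Suc n). last e = Suc n} = (\<lambda>e. e @ [Suc n]) ` U_seqs n"
  proof (intro equalityI subsetI)
    fix e assume e: "e \<in> {e \<in> U_seqs (Suc n). last e = Suc n}"
    then have len: "length e = Suc n" using U_seqs_length by blast
    then have eq: "e = butlast e @ [Suc n]" using e append_butlast_last_id[of e] by force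
    have "steep (butlast e)"
      using e eq steep_subseq[of e "butlast e"] by (metis (no_types, lifting) U_seqs_altdef mem_Collect_eq
          prefix_imp_subseq prefixI)
    moreover have "1 \<le> butlast e ! k \<and> butlast e ! k \<le> Suc k" if "k < n" for k
      using U_seqs_nth[of e "Suc n" k] e that len by (simp add: nth_butlast)
    ultimately have "butlast e \<in> U_seqs n" using len by (simp add: U_seqs_altdef)
    with eq show "e \<in> (\<lambda>e. e @ [Suc n]) ` U_seqs n" by blast
  next
    fix e assume "e \<in> (\<lambda>e. e @ [Suc n]) ` U_seqs n"
    then obtain u where u: "u \<in> U_seqs n" "e = u @ [Suc n]" by blast
    have "steep e"
      unfolding steep_def
    proof (intro notI, elim exE conjE)
      fix a b c assume sub: "subseq [a, b, c] e" and le: "b \<le> a" "c < a"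
      have "set e \<subseteq> {1..Suc n}" using U_seqs_set[OF u(1)] u(2) by auto
      then have "a \<le> Suc n" using subseq_set[OF sub] by auto
      \<comment> \<open>A triple whose first value is at most \<open>n\<close> avoids the last entry
        altogether; one starting with \<open>Suc n\<close> would have to start at the last
        position.\<close>
      then have "subseq [a, b, c] (filter (\<lambda>x. x \<le> n) e) \<or> a = Suc n"
        using sub le by (auto simp: subseq_filter_iff)
      moreover have "filter (\<lambda>x. x \<le> n) e = u"
        using U_seqs_set[OF u(1)] u(2) by (auto simp: filter_id_conv)
      moreover have "a \<noteq> Suc n"
      proof
        assume "a = Suc n"
        then have "a \<notin> set u" using U_seqs_set[OF u(1)] by auto
        then have "subseq [a, b, c] [Suc n]" using sub u(2) by (simp add: subseq_Cons_append)
        then show False by (simp split: if_splits)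
      qed
      ultimately show False using u(1) le unfolding U_seqs_altdef steep_def by blast
    qed
    then show "e \<in> {e \<in> U_seqs (Suc n). last e = Suc n}"
      using u U_seqs_nth[OF u(1)] U_seqs_length[OF u(1)]
      by (auto simp: U_seqs_altdef nth_append less_Suc_eq)
  qed
  moreover have "num_distinct (e @ [Suc n]) - 1 = Suc (num_distinct e - 1)" if "e \<in> U_seqs n" for e
  proof -
    have "Suc n \<notin> set e" using U_seqs_set[OF that] by auto
    moreover have "card (set e) \<ge> 1"
      using U_seqs_length[OF that] assms by (cases e) (auto simp: card_gt_0_iff Suc_le_eq)
    ultimately show ?thesis by (simp add: num_distinct_def)
  qed
  moreover have "inj_on (\<lambda>e. e @ [Suc n]) A" for A :: "nat list set" by (simp add: inj_on_def)
  ultimately have "U_sum q (Suc n) (Suc n) = q * (\<Sum>e\<in>U_seqs n. q ^ (num_distinct e - 1))"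
    unfolding U_sum_def by (simp add: sum.reindex sum_distrib_left)
  then show ?thesis by (simp only: sum_U_seqs_by_last(1)[OF assms])
qed

lemma conv_array_U_sum: "conv_array q (U_sum q)"
proof -
  let ?C = "conv_coeff q (U_sum q)"
  have C1: "?C 1 = prefix_coeff q 1 + q"
    using prefix_coeff_eq[of 1 q] by (simp add: conv_coeff_def U_sum_1)
  have C: "?C k = prefix_coeff q k" if "k \<ge> 2" for k
    using prefix_coeff_eq[of k q] that by (simp add: conv_coeff_def)
  have two: "U_sum q 2 1 = 1"
    using U_sum_below[of 1 2 q] by (simp add: U_sum_1)
  \<comment> \<open>With last entry \<open>n\<close> in length \<open>Suc n\<close>, every cut
    before \<open>n\<close> leaves a remainder ending in its own length. \<open>U_sum_diag\<close>
    turns these diagonal entries into totals, which \<open>U_total_below\<close> sums up.\<close>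
  have penultimate: "U_sum q (Suc n) n = ?C n" if n: "n \<ge> 2" for n
  proof -
    have "(\<Sum>k\<in>{1..<n}. prefix_coeff q k * (if k \<le> n then U_sum q (Suc n - k) (n + 1 - k) else 0)) =
        (\<Sum>k\<in>{1..<n}. prefix_coeff q k * (q * (\<Sum>i\<in>{1..n - k}. U_sum q (n - k) i)))"
    proof (intro sum.cong refl)
      fix k assume k: "k \<in> {1..<n}"
      then have "1 \<le> n - k" by auto
      then show "prefix_coeff q k * (if k \<le> n then U_sum q (Suc n - k) (n + 1 - k) else 0) =
          prefix_coeff q k * (q * (\<Sum>i\<in>{1..n - k}. U_sum q (n - k) i))"
        using U_sum_diag[of "n - k" q] k by (simp add: Suc_diff_le)
    qed
    also have "\<dots> = q * (\<Sum>i\<in>{1..<n}. U_sum q n i)"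
      using U_total_below[of n q] n by (simp add: sum_distrib_left mult_ac)
    finally have "U_sum q (Suc n) n = q * (\<Sum>i\<in>{1..<n}. U_sum q n i) + U_sum q n n"
      using U_sum_below[of n "Suc n" q] n by simp
    then show ?thesis using n by (simp add: conv_coeff_def)
  qed
  have "U_sum q n i = (\<Sum>k\<in>{1..i}. ?C k * U_sum q (n - k) (i + 1 - k))"
    if i: "1 \<le> i" "i + 2 \<le> n" for n i
  proof -
    have "i \<noteq> n - 1" "i < n" using i by linarith+
    then have "U_sum q n i = (\<Sum>k\<in>{1..<n - 1}. prefix_coeff q k *
        (if k \<le> i then U_sum q (n - k) (i + 1 - k) else 0)) + q * U_sum q (n - 1) i"
      using U_sum_below[of i n q] i(1) by simp
    also have "(\<Sum>k\<in>{1..<n - 1}. prefix_coeff q k *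
        (if k \<le> i then U_sum q (n - k) (i + 1 - k) else 0)) =
        (\<Sum>k\<in>{1..i}. prefix_coeff q k * U_sum q (n - k) (i + 1 - k))"
      using i by (intro sum.mono_neutral_cong_right) auto
    \<comment> \<open>The contribution \<open>q * U_sum q (n - 1) i\<close> of the cut at
      \<open>n - 1\<close> joins the summand \<open>k = 1\<close>, which contains the same array
      entry.\<close>
    also have "{1..i} = insert 1 {2..i}" using i by auto
    also have "(\<Sum>k\<in>insert 1 {2..i}. prefix_coeff q k * U_sum q (n - k) (i + 1 - k)) + q * U_sum q (n - 1) i =
        ?C 1 * U_sum q (n - 1) i + (\<Sum>k\<in>{2..i}. prefix_coeff q k * U_sum q (n - k) (i + 1 - k))"
      unfolding C1 by (simp add: algebra_simps)
    also have "\<dots> = (\<Sum>k\<in>insert 1 {2..i}. ?C k * U_sum q (n - k) (i + 1 - k))"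
      using C by simp
    finally show ?thesis using i by (simp add: insert_absorb atLeastAtMost_insertL numeral_2_eq_2)
  qed
  then show ?thesis
    unfolding conv_array_def using U_sum_1[of q] two U_sum_diag[of _ q] penultimate by simp
qed

lemma perm_sum_eq_U_sum: "1 \<le> i \<Longrightarrow> i \<le> n \<Longrightarrow> perm_sum q n i = U_sum q n i"
  using conv_array_unique[OF conv_array_perm_sum conv_array_U_sum] .

section \<open>Generating functions\<close>

text \<open>The second entry lies in \<open>{1..n}\<close> and differs from the first, so the
  refinement by \<open>j\<close> misses no permutation.\<close>

lemma a_poly_sum:
  assumes "n \<ge> 2" "i \<in> {1..n}"
  shows "(\<Sum>j\<in>{1..n} - {i}. a_poly n i j) = perm_sum (monom 1 1) n i"
proof -
  have "w ! 1 \<in> {1..n} - {i}" if "w \<in> avoiding_perms n" "w ! 0 = i" for w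
  proof -
    have "distinct w" using that(1) by (simp add: avoiding_perms_altdef permutations_of_set_def)
    then have "w ! 1 \<noteq> w ! 0"
      using avoiding_permsD(2)[OF that(1)] assms(1) by (simp add: nth_eq_iff_index_eq)
    moreover have "w ! 1 \<in> set w" using avoiding_permsD(2)[OF that(1)] assms(1) by (intro nth_mem) simp
    ultimately show ?thesis using avoiding_permsD(1)[OF that(1)] that(2) by auto
  qed
  then have heads: "(\<lambda>w. w ! 1) ` {w \<in> avoiding_perms n. w ! 0 = i} \<subseteq> {1..n} - {i}" by blast
  have "(\<Sum>j\<in>{1..n} - {i}. a_poly n i j) =
      (\<Sum>j\<in>{1..n} - {i}. \<Sum>w\<in>{w \<in> {w \<in> avoiding_perms n. w ! 0 = i}. w ! 1 = j}. monom 1 (desc w))"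
    unfolding a_poly_def by (intro sum.cong refl) auto
  also have "\<dots> = (\<Sum>w\<in>{w \<in> avoiding_perms n. w ! 0 = i}. monom 1 (desc w))"
    by (rule sum.group[OF _ _ heads]) (simp_all add: finite_avoiding_perms)
  finally show ?thesis by (simp add: perm_sum_def monom_power)
qed

text \<open>All entries are positive, so 0 arises only as the default for sequences without weak
  descent. Such a sequence increases strictly, hence its \<open>k\<close>-th entry is at least
  \<open>k\<close>; it is also at most \<open>k\<close>.\<close>

lemma hght_0_iff:
  assumes "e \<in> U_seqs n" "n \<ge> 1"
  shows "hght e = 0 \<longleftrightarrow> e = [1..<Suc n]"
proof -
  define H where "H = {e ! k | k. Suc k < length e \<and> e ! k \<ge> e ! Suc k}"
  have len: "length e = n" using U_seqs_length[OF assms(1)] .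
  have "finite H" unfolding H_def by (rule finite_subset[of _ "set e"]) auto
  moreover have "0 \<notin> H" using U_seqs_nth[OF assms(1)] len unfolding H_def by fastforce
  ultimately have "hght e = 0 \<longleftrightarrow> H = {}"
    unfolding hght_def H_def[symmetric] Let_def using Max_in[of H] by metis
  also have "\<dots> \<longleftrightarrow> e = [1..<Suc n]"
  proof
    assume "H = {}"
    then have inc: "e ! k < e ! Suc k" if "Suc k < n" for k
      using that len unfolding H_def by force
    have "Suc k \<le> e ! k" if "k < n" for k
      using that
    proof (induction k)
      case 0
      then show ?case using U_seqs_nth[OF assms(1), of 0] by simp
    next
      case (Suc k)
      then show ?case using inc[of k] by simp
    qed
    then have "e ! k = Suc k" if "k < n" for k
      using U_seqs_nth[OF assms(1) that] that by (simp add: le_antisym)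
    then show "e = [1..<Suc n]"
      using len by (intro nth_equalityI) (auto simp del: upt_Suc)
  next
    assume "e = [1..<Suc n]"
    then show "H = {}" unfolding H_def by (auto simp del: upt_Suc)
  qed
  finally show ?thesis .
qed

lemma identity_in_U_seqs: "[1..<Suc n] \<in> U_seqs n"
  unfolding U_seqs_def by (auto simp del: upt_Suc)

lemma hght_le:
  assumes "e \<in> U_seqs n" "n \<ge> 2"
  shows "hght e \<le> n - 1"
proof -
  define H where "H = {e ! k | k. Suc k < length e \<and> e ! k \<ge> e ! Suc k}"
  have len: "length e = n" using U_seqs_length[OF assms(1)] .
  have "finite H" unfolding H_def by (rule finite_subset[of _ "set e"]) auto
  moreover have "x \<le> n - 1" if "x \<in> H" for x
  proof -
    from that obtain k where "Suc k < n" "x = e ! k" using len unfolding H_def by auto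
    then show ?thesis using U_seqs_nth[OF assms(1), of k] by linarith
  qed
  ultimately show ?thesis
    unfolding hght_def H_def[symmetric] Let_def by auto
qed

text \<open>The heights from 1 to \<open>n - 1\<close> cover every sequence but the identity, which
  has height 0, last entry \<open>n\<close> and weight \<open>q ^ (n - 1)\<close>. These omitted
  terms form the geometric series.\<close>

lemma u_poly_sum:
  assumes "n \<ge> 2" "i \<in> {1..n}"
  shows "(\<Sum>j\<in>{1..n-1}. u_poly n i j) + (if i = n then monom 1 (n - 1) else 0) =
    U_sum (monom 1 1) n i"
proof -
  let ?S = "{e \<in> U_seqs n. last e = i}" and ?h = "\<lambda>e. monom (1 :: int) (num_distinct e - 1)"
  have fin: "finite ?S" by (simp add: finite_U_seqs)
  have "U_sum (monom 1 1) n i = sum ?h ?S"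
    by (simp add: U_sum_def monom_power)
  also have "\<dots> = (\<Sum>j\<in>{0..n - 1}. sum ?h {e \<in> ?S. hght e = j})"
    by (rule sum.group[symmetric]) (use fin hght_le assms in auto)
  also have "{0..n - 1} = insert 0 {1..n - 1}" by auto
  also have "(\<Sum>j\<in>insert 0 {1..n - 1}. sum ?h {e \<in> ?S. hght e = j}) =
      (\<Sum>j\<in>{1..n - 1}. sum ?h {e \<in> ?S. hght e = j}) + sum ?h {e \<in> ?S. hght e = 0}"
    by (simp add: add.commute)
  also have "(\<Sum>j\<in>{1..n - 1}. sum ?h {e \<in> ?S. hght e = j}) = (\<Sum>j\<in>{1..n-1}. u_poly n i j)"
    unfolding u_poly_def by (intro sum.cong refl) auto
  also have "sum ?h {e \<in> ?S. hght e = 0} = (if i = n then monom 1 (n - 1) else 0)"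
  proof -
    have "last [1..<Suc n] = n" using assms by simp
    then have "e \<in> U_seqs n \<and> last e = i \<and> hght e = 0 \<longleftrightarrow> e = [1..<Suc n] \<and> i = n" for e
      using hght_0_iff[of e n] identity_in_U_seqs[of n] assms(1) by fastforce
    then have "{e \<in> ?S. hght e = 0} = (if i = n then {[1..<Suc n]} else {})"
      by (auto simp del: upt_Suc)
    moreover have "num_distinct [1..<Suc n] = n"
      unfolding num_distinct_def by (simp del: upt_Suc)
    ultimately show ?thesis by (simp del: upt_Suc)
  qed
  finally show ?thesis ..
qed

text \<open>The outer monomial is the power of \<open>v\<close>, the inner one the power of
  \<open>q\<close>.\<close>

definition geom_gf :: "coeff_field fps" where
  "geom_gf = Abs_fps (\<lambda>n. if n = 0 then 0 else to_fract (monom (monom 1 (n - 1)) n))"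

lemma geom_gf_eq: "var_v * fps_X / (1 - var_v * var_q * fps_X) = geom_gf"
proof -
  have vq: "var_v * var_q = fps_const (to_fract (monom (monom 1 1) 1))"
    by (simp add: var_v_def var_q_def to_fract_mult[symmetric] mult_monom flip: monom_0)
  have step: "to_fract (monom (monom 1 1) 1) * to_fract (monom (monom 1 k) n) =
      (to_fract (monom (monom 1 (Suc k)) (Suc n)) :: coeff_field)" for k n
    by (simp add: mult_monom flip: to_fract_mult)
  have "geom_gf * (1 - var_v * var_q * fps_X) = var_v * fps_X"
  proof (rule fps_ext)
    fix n
    have "fps_nth (geom_gf * (1 - var_v * var_q * fps_X)) n =
        fps_nth geom_gf n - fps_nth (var_v * var_q * (geom_gf * fps_X)) n"
      by (simp add: algebra_simps)
    also have "\<dots> = fps_nth (var_v * fps_X) n"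
    proof (cases n)
      case 0
      then show ?thesis by (simp add: geom_gf_def)
    next
      \<comment> \<open>For \<open>m = 0\<close> the subtracted coefficient vanishes and
        \<open>v\<close> remains; otherwise the two coefficients cancel.\<close>
      case (Suc m)
      then show ?thesis
        unfolding vq using step[of "m - 1" m]
        by (cases m) (simp_all add: geom_gf_def var_v_def)
    qed
    finally show "fps_nth (geom_gf * (1 - var_v * var_q * fps_X)) n = fps_nth (var_v * fps_X) n" .
  qed
  moreover have "fps_nth (1 - var_v * var_q * fps_X) 0 \<noteq> 0" by simp
  ultimately show ?thesis
    by (metis fps_nonzero_nth nonzero_mult_div_cancel_right)
qed

lemma monom_sum: "(\<Sum>j\<in>J. monom (g j) i) = monom (\<Sum>j\<in>J. g j) i"
  by (induction J rule: infinite_finite_induct) (auto simp: add_monom)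

theorem theorem11:
  shows "A_gf + var_v * fps_X = U_gf + var_v * fps_X / (1 - var_v * var_q * fps_X)"
  unfolding geom_gf_eq
proof (rule fps_ext)
  fix n :: nat
  consider "n = 0" | "n = 1" | "n \<ge> 2" by linarith
  then show "fps_nth (A_gf + var_v * fps_X) n = fps_nth (U_gf + geom_gf) n"
  proof cases
    case 3
    \<comment> \<open>For each \<open>i\<close> both sums over \<open>j\<close> come from the common
      array; the identity sequence accounts for the extra term at \<open>i = n\<close>.\<close>
    have "(\<Sum>i\<in>{1..n}. \<Sum>j\<in>{1..n} - {i}. monom (a_poly n i j) i) =
        (\<Sum>i\<in>{1..n}. monom (\<Sum>j\<in>{1..n-1}. u_poly n i j) i + (if i = n then monom (monom 1 (n - 1)) n else 0))"
    proof (rule sum.cong[OF refl])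
      fix i assume i: "i \<in> {1..n}"
      have "(\<Sum>j\<in>{1..n} - {i}. a_poly n i j) =
          (\<Sum>j\<in>{1..n-1}. u_poly n i j) + (if i = n then monom 1 (n - 1) else 0)"
        using a_poly_sum[OF 3 i] u_poly_sum[OF 3 i] perm_sum_eq_U_sum[of i n "monom 1 1"] i by simp
      then show "(\<Sum>j\<in>{1..n} - {i}. monom (a_poly n i j) i) =
          monom (\<Sum>j\<in>{1..n-1}. u_poly n i j) i + (if i = n then monom (monom 1 (n - 1)) n else 0)"
        unfolding monom_sum by (simp add: add_monom)
    qed
    also have "\<dots> = (\<Sum>i\<in>{1..n}. \<Sum>j\<in>{1..n-1}. monom (u_poly n i j) i) + monom (monom 1 (n - 1)) n"
      using 3 by (simp add: sum.distrib monom_sum)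
    finally have eq: "(\<Sum>i\<in>{1..n}. \<Sum>j\<in>{1..n} - {i}. monom (a_poly n i j) i) =
        (\<Sum>i\<in>{1..n}. \<Sum>j\<in>{1..n-1}. monom (u_poly n i j) i) + monom (monom 1 (n - 1)) n" .
    have "fps_nth (A_gf + var_v * fps_X) n =
        to_fract (\<Sum>i\<in>{1..n}. \<Sum>j\<in>{1..n} - {i}. monom (a_poly n i j) i)"
      using 3 by (simp add: A_gf_def var_v_def)
    also have "\<dots> = to_fract (\<Sum>i\<in>{1..n}. \<Sum>j\<in>{1..n-1}. monom (u_poly n i j) i) +
        to_fract (monom (monom 1 (n - 1)) n)"
      unfolding eq to_fract_add ..
    also have "\<dots> = fps_nth (U_gf + geom_gf) n"
      using 3 by (simp add: U_gf_def geom_gf_def)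
    finally show ?thesis .
  \<comment> \<open>Both series start at \<open>n = 2\<close>. For \<open>n = 1\<close> the term
    \<open>var_v * fps_X\<close> on the left matches the first term of the geometric series.\<close>
  qed (simp_all add: A_gf_def U_gf_def geom_gf_def var_v_def)
qed

end
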